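(* Let $\mathcal{B}$ be a bialgebra with an additive deformation $(\mu_t)_{t\in\mathbb{R}}$, $\mu_t=\mu\star e_\star^{tL}$ for a normalized, commuting 2-cocycle $L$, and write $\mathcal{B}_t=(\mathcal{B},\mu_t,\mathbf 1)$. If a family $(S_t)_{t\in\mathbb{R}}$ of linear maps $S_t:\mathcal{B}\to\mathcal{B}$ with $$\mu_t\circ(S_t\otimes\mathrm{id})\circ\Delta=\mu_t\circ(\mathrm{id}\otimes S_t)\circ\Delta=\mathbf 1\delta\qquad\text{for all }t\in\mathbb{R}$$ exists, it is uniquely determined and the following statements hold: 1. $S_t(\mathbf 1)=\mathbf 1$ for all $t\in\mathbb{R}$. 2. $S_t:\mathcal{B}_{-t}\to\mathcal{B}_t$ is an algebra antihomomorphism for all $t\in\mathbb{R}$, i.e. $S_t\circ\mu_{-t}=\mu_t\circ(S_t\otimes S_t)\circ\tau$. 3. $\Delta\circ S_{t+r}=(S_t\otimes S_r)\circ\tau\circ\Delta$ for all $t,r\in\mathbb{R}$. 4. If $\mathcal{B}$ is cocommutative, i.e. $\Delta=\tau\circ\Delta$, then $S_t$ is invertible for all $t\in\mathbb{R}$ and $(S_t)^{-1}=S_{-t}$.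
   Context: All vector spaces are over $\mathbb{C}$. $(\mathcal{B},\mu,\mathbf 1,\Delta,\delta)$: multiplication, unit, comultiplication, counit; $\tau$ is the flip on $\mathcal B\otimes\mathcal B$; $\mathbf 1\delta$ is the map $a\mapsto\delta(a)\mathbf 1$. $\mathcal{B}\otimes\mathcal{B}$ is a coalgebra with comultiplication $(\mathrm{id}\otimes\tau\otimes\mathrm{id})\circ(\Delta\otimes\Delta)$ and counit $\delta\otimes\delta$. Convolution with functionals: $(\mu\star L)(a\otimes b)=a_{(1)}b_{(1)}L(a_{(2)}\otimes b_{(2)})$, $(L\star\mu)(a\otimes b)=L(a_{(1)}\otimes b_{(1)})a_{(2)}b_{(2)}$, $(L\star L')(a\otimes b)=L(a_{(1)}\otimes b_{(1)})L'(a_{(2)}\otimes b_{(2)})$; $e_\star^{tL}=\sum_{n\ge0}t^nL^{\star n}/n!$ (pointwise convergent), with $L^{\star0}=\delta\otimes\delta$. A linear map $L:\mathcal{B}\otimes\mathcal{B}\to\mathbb{C}$ is commuting if $\mu\star L=L\star\mu$, normalized if $L(\mathbf 1\otimes\mathbf 1)=0$, and a 2-cocycle if $\delta(a)L(b\otimes c)-L(ab\otimes c)+L(a\otimes bc)-L(a\otimes b)\delta(c)=0$ for all $a,b,c\in\mathcal{B}$. An additive deformation of $\mathcal{B}$ is a family $(\mu_t)_{t\ge0}$ of linear maps $\mathcal{B}\otimes\mathcal{B}\to\mathcal{B}$ with $(\mathcal{B},\mu_t,\mathbf 1)$ a unital algebra, $\mu_0=\mu$, $\Delta\circ\mu_{t+s}=(\mu_t\otimes\mu_s)\circ(\mathrm{id}\otimes\tau\otimes\mathrm{id})\circ(\Delta\otimes\Delta)$,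 and $\delta\circ\mu_t\to\delta\otimes\delta$ pointwise as $t\to0$. By a theorem of Wirth (known), these are exactly the families $\mu_t=\mu\star e_\star^{tL}$ with $L$ a normalized commuting 2-cocycle; they are viewed as indexed by all $t\in\mathbb{R}$ through this formula (each $\mathcal{B}_t$, $t\in\mathbb{R}$, is a unital algebra, and $\Delta:\mathcal{B}_{t+s}\to\mathcal{B}_t\otimes\mathcal{B}_s$ is an algebra homomorphism for all $s,t\in\mathbb{R}$). *)

theory Defs
  imports Complex_Main "HOL-Library.Poly_Mapping"
begin

section \<open>Complex vector spaces\<close>

class complex_vector = ab_group_add +
  fixes scaleC :: "complex \<Rightarrow> 'a \<Rightarrow> 'a"  (infixr \<open>*\<^sub>C\<close> 75)
  assumes scaleC_add_right: "c *\<^sub>C (x + y) = c *\<^sub>C x + c *\<^sub>C y"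
    and scaleC_add_left: "(c + d) *\<^sub>C x = c *\<^sub>C x + d *\<^sub>C x"
    and scaleC_scaleC: "c *\<^sub>C d *\<^sub>C x = (c * d) *\<^sub>C x"
    and scaleC_one: "1 *\<^sub>C x = x"

global_interpretation cvs: vector_space "scaleC :: complex \<Rightarrow> 'a \<Rightarrow> 'a::complex_vector"
  by unfold_locales (simp_all add: scaleC_add_right scaleC_add_left scaleC_scaleC scaleC_one)

instantiation complex :: complex_vector
begin

definition scaleC_complex :: "complex \<Rightarrow> complex \<Rightarrow> complex"
  where scaleC_complex_eq [simp]: "scaleC_complex c x = c * x"

instance
  by standard (simp_all add: algebra_simps)

end

abbreviation clinear :: "('a::complex_vector \<Rightarrow> 'b::complex_vector) \<Rightarrow> bool"
  where "clinear \<equiv> Vector_Spaces.linear scaleC scaleC"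

lemma clinear_iff:
  "clinear f \<longleftrightarrow> (\<forall>x y. f (x + y) = f x + f y) \<and> (\<forall>c x. f (c *\<^sub>C x) = c *\<^sub>C f x)"
  by (simp add: Vector_Spaces.linear_iff cvs.vector_space_axioms)

lemma clinear_sum: "clinear f \<Longrightarrow> f (sum g A) = (\<Sum>a\<in>A. f (g a))"
  using module_hom.sum[OF Vector_Spaces.linear.axioms(3)] .

definition cbilinear :: "('a::complex_vector \<Rightarrow> 'b::complex_vector \<Rightarrow> 'c::complex_vector) \<Rightarrow> bool"
  where "cbilinear f \<longleftrightarrow> (\<forall>x. clinear (f x)) \<and> (\<forall>y. clinear (\<lambda>x. f x y))"


section \<open>The algebraic tensor product\<close>

text \<open>
  The tensor product is the free vector space on the set of pairs, modulo the subspace spanned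
  by the bilinearity relations.
\<close>

type_synonym ('a, 'b) free_prod = "('a \<times> 'b) \<Rightarrow>\<^sub>0 complex"

definition free_scale :: "complex \<Rightarrow> ('k \<Rightarrow>\<^sub>0 complex) \<Rightarrow> ('k \<Rightarrow>\<^sub>0 complex)"
  where "free_scale c = Poly_Mapping.map ((*) c)"

lemma lookup_free_scale [simp]: "Poly_Mapping.lookup (free_scale c p) k = c * Poly_Mapping.lookup p k"
  by (simp add: free_scale_def Poly_Mapping.map.rep_eq when_def)

global_interpretation free: vector_space "free_scale :: complex \<Rightarrow> ('k \<Rightarrow>\<^sub>0 complex) \<Rightarrow> _"
  by unfold_locales (rule poly_mapping_eqI, simp add: lookup_add distrib_left distrib_right)+

abbreviation free_gen :: "'a \<Rightarrow> 'b \<Rightarrow> ('a, 'b) free_prod"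
  where "free_gen x y \<equiv> Poly_Mapping.single (x, y) 1"

definition tensor_relations :: "('a::complex_vector, 'b::complex_vector) free_prod set"
  where "tensor_relations =
      {free_gen (x + x') y - free_gen x y - free_gen x' y | x x' y. True}
    \<union> {free_gen x (y + y') - free_gen x y - free_gen x y' | x y y'. True}
    \<union> {free_gen (c *\<^sub>C x) y - free_scale c (free_gen x y) | c x y. True}
    \<union> {free_gen x (c *\<^sub>C y) - free_scale c (free_gen x y) | c x y. True}"

definition tensor_rel ::
    "('a::complex_vector, 'b::complex_vector) free_prod \<Rightarrow> ('a, 'b) free_prod \<Rightarrow> bool"
  where "tensor_rel p q \<longleftrightarrow> p - q \<in> free.span tensor_relations"

lemma equivp_tensor_rel:
  "equivp (tensor_rel :: ('a::complex_vector, 'b::complex_vector) free_prod \<Rightarrow> _)"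
proof (rule equivpI)
  show "reflp (tensor_rel :: ('a, 'b) free_prod \<Rightarrow> _)"
    by (auto simp: reflp_def tensor_rel_def free.span_zero)
  show "symp (tensor_rel :: ('a, 'b) free_prod \<Rightarrow> _)"
  proof (rule sympI)
    fix p q :: "('a, 'b) free_prod"
    assume "tensor_rel p q"
    then show "tensor_rel q p"
      using free.span_neg[of "p - q" tensor_relations] by (simp add: tensor_rel_def)
  qed
  show "transp (tensor_rel :: ('a, 'b) free_prod \<Rightarrow> _)"
  proof (rule transpI)
    fix p q r :: "('a, 'b) free_prod"
    assume "tensor_rel p q" "tensor_rel q r"
    then show "tensor_rel p r"
      using free.span_add[of "p - q" tensor_relations "q - r"] by (simp add: tensor_rel_def)
  qed
qed

quotient_type (overloaded) ('a, 'b) tensor (infixr \<open>\<otimes>\<close> 65) =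
    "('a::complex_vector, 'b::complex_vector) free_prod" / tensor_rel
  by (rule equivp_tensor_rel)

instantiation tensor :: (complex_vector, complex_vector) complex_vector
begin

lift_definition zero_tensor :: "'a \<otimes> 'b" is 0 .

lift_definition plus_tensor :: "'a \<otimes> 'b \<Rightarrow> 'a \<otimes> 'b \<Rightarrow> 'a \<otimes> 'b" is "(+)"
  unfolding tensor_rel_def by (drule (1) free.span_add) (simp add: add_diff_add)

lift_definition minus_tensor :: "'a \<otimes> 'b \<Rightarrow> 'a \<otimes> 'b \<Rightarrow> 'a \<otimes> 'b" is "(-)"
  unfolding tensor_rel_def by (drule (1) free.span_diff) (simp add: algebra_simps)

lift_definition uminus_tensor :: "'a \<otimes> 'b \<Rightarrow> 'a \<otimes> 'b" is uminus
  unfolding tensor_rel_def by (drule free.span_neg) simp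

lift_definition scaleC_tensor :: "complex \<Rightarrow> 'a \<otimes> 'b \<Rightarrow> 'a \<otimes> 'b" is free_scale
  unfolding tensor_rel_def by (simp flip: free.scale_right_diff_distrib add: free.span_scale)

instance
proof
  note refl = equivp_reflp[OF equivp_tensor_rel]
  fix a b c :: "'a \<otimes> 'b" and s t :: complex
  show "a + b + c = a + (b + c)"
    by transfer (simp add: add.assoc refl)
  show "a + b = b + a"
    by transfer (simp add: add.commute refl)
  show "0 + a = a"
    by transfer (simp add: refl)
  show "- a + a = 0"
    by transfer (simp add: refl)
  show "a - b = a + - b"
    by transfer (simp add: refl)
  show "s *\<^sub>C (a + b) = s *\<^sub>C a + s *\<^sub>C b"
    by transfer (simp add: free.scale_right_distrib refl)
  show "(s + t) *\<^sub>C a = s *\<^sub>C a + t *\<^sub>C a"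
    by transfer (simp add: free.scale_left_distrib refl)
  show "s *\<^sub>C t *\<^sub>C a = (s * t) *\<^sub>C a"
    by transfer (simp add: refl)
  show "1 *\<^sub>C a = a"
    by transfer (simp add: refl)
qed

end

lift_definition tensor_elem ::
    "'a::complex_vector \<Rightarrow> 'b::complex_vector \<Rightarrow> 'a \<otimes> 'b" (infixr \<open>\<otimes>\<^sub>e\<close> 66)
  is free_gen .

lemma cbilinear_tensor_elem: "cbilinear (\<otimes>\<^sub>e)"
  unfolding cbilinear_def clinear_iff
proof (intro conjI allI)
  fix x x' :: "'a::complex_vector" and y y' :: "'b::complex_vector" and c :: complex
  show "x \<otimes>\<^sub>e (y + y') = x \<otimes>\<^sub>e y + x \<otimes>\<^sub>e y'"
    by transfer (unfold tensor_rel_def tensor_relations_def diff_diff_eq[symmetric],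
        rule free.span_base, blast)
  show "(x + x') \<otimes>\<^sub>e y = x \<otimes>\<^sub>e y + x' \<otimes>\<^sub>e y"
    by transfer (unfold tensor_rel_def tensor_relations_def diff_diff_eq[symmetric],
        rule free.span_base, blast)
  show "x \<otimes>\<^sub>e (c *\<^sub>C y) = c *\<^sub>C (x \<otimes>\<^sub>e y)"
    by transfer (unfold tensor_rel_def tensor_relations_def, rule free.span_base, blast)
  show "(c *\<^sub>C x) \<otimes>\<^sub>e y = c *\<^sub>C (x \<otimes>\<^sub>e y)"
    by transfer (unfold tensor_rel_def tensor_relations_def, rule free.span_base, blast)
qed

lemma tensor_sum_elems:
  fixes t :: "'a::complex_vector \<otimes> 'b::complex_vector"
  obtains p :: "('a, 'b) free_prod" where
    "t = (\<Sum>k\<in>Poly_Mapping.keys p. Poly_Mapping.lookup p k *\<^sub>C (fst k \<otimes>\<^sub>e snd k))"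
proof -
  obtain p where t: "t = abs_tensor p"
    by (metis Quotient3_abs_rep Quotient3_tensor)
  have abs_sum: "abs_tensor (sum f A) = (\<Sum>k\<in>A. abs_tensor (f k))"
    for f :: "_ \<Rightarrow> ('a, 'b) free_prod" and A :: "('a \<times> 'b) set"
    by (induction A rule: infinite_finite_induct)
       (simp_all add: zero_tensor.abs_eq plus_tensor.abs_eq[symmetric])
  have "p = (\<Sum>k\<in>Poly_Mapping.keys p. free_scale (Poly_Mapping.lookup p k) (free_gen (fst k) (snd k)))"
    by (rule poly_mapping_eqI)
       (simp add: lookup_sum lookup_single when_def if_distrib[of "\<lambda>z. _ * z"] in_keys_iff
          cong: if_cong)
  from arg_cong[where f = abs_tensor, OF this]
  have "t = (\<Sum>k\<in>Poly_Mapping.keys p. Poly_Mapping.lookup p k *\<^sub>C (fst k \<otimes>\<^sub>e snd k))"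
    unfolding t abs_sum scaleC_tensor.abs_eq tensor_elem.abs_eq .
  then show thesis
    by (rule that)
qed

lemma tensor_ext:
  fixes f g :: "'a::complex_vector \<otimes> 'b::complex_vector \<Rightarrow> 'c::complex_vector"
  assumes "clinear f" "clinear g" "\<And>x y. f (x \<otimes>\<^sub>e y) = g (x \<otimes>\<^sub>e y)"
  shows "f = g"
proof
  fix t :: "'a \<otimes> 'b"
  obtain p where t: "t = (\<Sum>k\<in>Poly_Mapping.keys p. Poly_Mapping.lookup p k *\<^sub>C (fst k \<otimes>\<^sub>e snd k))"
    by (rule tensor_sum_elems)
  show "f t = g t"
    using assms by (simp add: t clinear_sum) (simp add: clinear_iff)
qed

text \<open>The linear map on the tensor product induced by a bilinear map.\<close>

definition tensor_lift ::
    "('a::complex_vector \<Rightarrow> 'b::complex_vector \<Rightarrow> 'c::complex_vector) \<Rightarrow> 'a \<otimes> 'b \<Rightarrow> 'c"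
  where "tensor_lift f = (THE g. clinear g \<and> (\<forall>x y. g (x \<otimes>\<^sub>e y) = f x y))"

lemma ex_tensor_lift:
  fixes f :: "'a::complex_vector \<Rightarrow> 'b::complex_vector \<Rightarrow> 'c::complex_vector"
  assumes "cbilinear f"
  shows "\<exists>!g. clinear g \<and> (\<forall>x y. g (x \<otimes>\<^sub>e y) = f x y)"
proof -
  define ev :: "('a, 'b) free_prod \<Rightarrow> 'c"
    where "ev p = (\<Sum>k\<in>Poly_Mapping.keys p. Poly_Mapping.lookup p k *\<^sub>C f (fst k) (snd k))" for p
  have ev_superset: "ev p = (\<Sum>k\<in>A. Poly_Mapping.lookup p k *\<^sub>C f (fst k) (snd k))"
    if "finite A" "Poly_Mapping.keys p \<subseteq> A" for p A
    unfolding ev_def using that by (intro sum.mono_neutral_left) (auto simp: in_keys_iff)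
  have ev_add: "ev (p + q) = ev p + ev q" for p q
    using keys_add[of p q]
    by (simp add: ev_superset[of "Poly_Mapping.keys p \<union> Poly_Mapping.keys q"]
        lookup_add scaleC_add_left sum.distrib)
  have ev_scale: "ev (free_scale c p) = c *\<^sub>C ev p" for c p
    by (subst (1 2) ev_superset[of "Poly_Mapping.keys p"])
       (auto simp: in_keys_iff cvs.scale_sum_right)
  have ev_diff: "ev (p - q) = ev p - ev q" for p q
    using ev_add[of "p - q" q] by simp
  have ev_gen: "ev (free_gen x y) = f x y" for x y
    by (simp add: ev_def)
  have ev_relations: "ev r = 0" if "r \<in> tensor_relations" for r
    using that assms
    by (auto simp: tensor_relations_def ev_diff ev_scale ev_gen cbilinear_def clinear_iff)
  have ev_span: "ev r = 0" if "r \<in> free.span tensor_relations" for r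
    using that
  proof (induction rule: free.span_induct_alt)
    case base
    show ?case by (simp add: ev_def)
  qed (simp add: ev_add ev_scale ev_relations)
  define g where "g t = ev (rep_tensor t)" for t
  have g_abs: "g (abs_tensor p) = ev p" for p
  proof -
    have "tensor_rel (rep_tensor (abs_tensor p)) p"
      by (rule Quotient3_rep_abs[OF Quotient3_tensor equivp_reflp[OF equivp_tensor_rel]])
    then have "ev (rep_tensor (abs_tensor p) - p) = 0"
      unfolding tensor_rel_def by (rule ev_span)
    then show ?thesis
      by (simp add: ev_diff g_def)
  qed
  have "clinear g"
    unfolding clinear_iff
  proof (intro conjI allI)
    fix s t :: "'a \<otimes> 'b" and c :: complex
    obtain p q where "s = abs_tensor p" "t = abs_tensor q"
      by (metis Quotient3_abs_rep Quotient3_tensor)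
    then show "g (s + t) = g s + g t" "g (c *\<^sub>C s) = c *\<^sub>C g s"
      by (simp_all add: plus_tensor.abs_eq scaleC_tensor.abs_eq g_abs ev_add ev_scale)
  qed
  moreover have "g (x \<otimes>\<^sub>e y) = f x y" for x y
    by (simp add: tensor_elem.abs_eq g_abs ev_gen)
  ultimately show ?thesis
    by (metis tensor_ext)
qed

lemma
  assumes "cbilinear f"
  shows clinear_tensor_lift: "clinear (tensor_lift f)"
    and tensor_lift_elem [simp]: "tensor_lift f (x \<otimes>\<^sub>e y) = f x y"
  using theI'[OF ex_tensor_lift[OF assms]] by (auto simp: tensor_lift_def)

definition tensor_map :: "('a::complex_vector \<Rightarrow> 'c::complex_vector) \<Rightarrow>
    ('b::complex_vector \<Rightarrow> 'd::complex_vector) \<Rightarrow> 'a \<otimes> 'b \<Rightarrow> 'c \<otimes> 'd"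
  where "tensor_map f g = tensor_lift (\<lambda>x y. f x \<otimes>\<^sub>e g y)"

definition flip :: "'a::complex_vector \<otimes> 'b::complex_vector \<Rightarrow> 'b \<otimes> 'a"
  where "flip = tensor_lift (\<lambda>x y. y \<otimes>\<^sub>e x)"

definition tensor_assoc ::
    "('a::complex_vector \<otimes> 'b::complex_vector) \<otimes> 'c::complex_vector \<Rightarrow> 'a \<otimes> ('b \<otimes> 'c)"
  where "tensor_assoc = tensor_lift (\<lambda>s z. tensor_lift (\<lambda>x y. x \<otimes>\<^sub>e (y \<otimes>\<^sub>e z)) s)"

text \<open>
  The map \<open>id \<otimes> \<tau> \<otimes> id\<close>, on \<open>(A \<otimes> B) \<otimes> (C \<otimes> D)\<close>; the tensor product of types is not
  strictly associative.
\<close>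

definition middle_flip ::
    "('a::complex_vector \<otimes> 'b::complex_vector) \<otimes> ('c::complex_vector \<otimes> 'd::complex_vector)
      \<Rightarrow> ('a \<otimes> 'c) \<otimes> ('b \<otimes> 'd)"
  where "middle_flip = tensor_lift (\<lambda>s t.
      tensor_lift (\<lambda>a b. tensor_lift (\<lambda>c d. (a \<otimes>\<^sub>e c) \<otimes>\<^sub>e (b \<otimes>\<^sub>e d)) t) s)"

definition functional_tensor :: "('a::complex_vector \<Rightarrow> complex) \<Rightarrow>
    ('b::complex_vector \<Rightarrow> complex) \<Rightarrow> 'a \<otimes> 'b \<Rightarrow> complex"
  where "functional_tensor f g = tensor_lift (\<lambda>x y. f x * g y)"

lemma tensor_elem_simps:
  fixes x x' :: "'a::complex_vector" and y y' :: "'b::complex_vector"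
  shows "(x + x') \<otimes>\<^sub>e y = x \<otimes>\<^sub>e y + x' \<otimes>\<^sub>e y" "x \<otimes>\<^sub>e (y + y') = x \<otimes>\<^sub>e y + x \<otimes>\<^sub>e y'"
  "(c *\<^sub>C x) \<otimes>\<^sub>e y = c *\<^sub>C (x \<otimes>\<^sub>e y)" "x \<otimes>\<^sub>e (c *\<^sub>C y) = c *\<^sub>C (x \<otimes>\<^sub>e y)"
  using cbilinear_tensor_elem[where 'a = 'a and 'b = 'b] by (auto simp: cbilinear_def clinear_iff)

lemma tensor_map_elem:
  "clinear f \<Longrightarrow> clinear g \<Longrightarrow> tensor_map f g (x \<otimes>\<^sub>e y) = f x \<otimes>\<^sub>e g y"
  unfolding tensor_map_def
  by (subst tensor_lift_elem) (auto simp: cbilinear_def clinear_iff tensor_elem_simps)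

lemma flip_elem: "flip (x \<otimes>\<^sub>e y) = y \<otimes>\<^sub>e x"
  unfolding flip_def
  by (subst tensor_lift_elem) (auto simp: cbilinear_def clinear_iff tensor_elem_simps)

lemma functional_tensor_elem:
  "clinear f \<Longrightarrow> clinear g \<Longrightarrow> functional_tensor f g (x \<otimes>\<^sub>e y) = f x * g y"
  unfolding functional_tensor_def
  by (subst tensor_lift_elem) (auto simp: cbilinear_def clinear_iff algebra_simps)

lemma clinear_tensor_lift_param:
  assumes "\<And>z. cbilinear (f z)" and "\<And>x y. clinear (\<lambda>z. f z x y)"
  shows "clinear (\<lambda>z. tensor_lift (f z) t)"
proof -
  obtain p where t: "t = (\<Sum>k\<in>Poly_Mapping.keys p. Poly_Mapping.lookup p k *\<^sub>C (fst k \<otimes>\<^sub>e snd k))"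
    by (rule tensor_sum_elems)
  have *: "tensor_lift (f z) t
      = (\<Sum>k\<in>Poly_Mapping.keys p. Poly_Mapping.lookup p k *\<^sub>C f z (fst k) (snd k))" for z
    using clinear_tensor_lift[OF assms(1)[of z]] tensor_lift_elem[OF assms(1)[of z]]
    by (simp add: t clinear_sum) (simp add: clinear_iff)
  show ?thesis
    using assms(2)
    by (simp add: * clinear_iff scaleC_add_right sum.distrib cvs.scale_sum_right mult.commute)
qed

lemma tensor_assoc_elem:
  fixes x :: "'a::complex_vector" and y :: "'b::complex_vector" and z :: "'c::complex_vector"
  shows "tensor_assoc ((x \<otimes>\<^sub>e y) \<otimes>\<^sub>e z) = x \<otimes>\<^sub>e (y \<otimes>\<^sub>e z)"
proof -
  have bil: "cbilinear (\<lambda>x y. x \<otimes>\<^sub>e (y \<otimes>\<^sub>e z))" for z :: 'c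
    by (auto simp: cbilinear_def clinear_iff tensor_elem_simps)
  have lin: "clinear (\<lambda>z. x \<otimes>\<^sub>e (y \<otimes>\<^sub>e z))" for x :: 'a and y :: 'b
    by (auto simp: clinear_iff tensor_elem_simps)
  have "cbilinear (\<lambda>s (z::'c). tensor_lift (\<lambda>(x::'a) (y::'b). x \<otimes>\<^sub>e (y \<otimes>\<^sub>e z)) s)"
    unfolding cbilinear_def
    by (intro conjI allI clinear_tensor_lift clinear_tensor_lift_param bil lin)
  then show ?thesis
    unfolding tensor_assoc_def by (simp add: bil)
qed

lemma middle_flip_elem:
  fixes a :: "'a::complex_vector" and b :: "'b::complex_vector"
    and c :: "'c::complex_vector" and d :: "'d::complex_vector"
  shows "middle_flip ((a \<otimes>\<^sub>e b) \<otimes>\<^sub>e (c \<otimes>\<^sub>e d)) = (a \<otimes>\<^sub>e c) \<otimes>\<^sub>e (b \<otimes>\<^sub>e d)"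
proof -
  have bil: "cbilinear (\<lambda>(c::'c) (d::'d). (a \<otimes>\<^sub>e c) \<otimes>\<^sub>e (b \<otimes>\<^sub>e d))"
    for a :: 'a and b :: 'b
    by (auto simp: cbilinear_def clinear_iff tensor_elem_simps)
  have bil2: "cbilinear (\<lambda>(a::'a) (b::'b). tensor_lift (\<lambda>c d. (a \<otimes>\<^sub>e c) \<otimes>\<^sub>e (b \<otimes>\<^sub>e d)) t)"
    for t :: "'c \<otimes> 'd"
    unfolding cbilinear_def
    by (intro conjI allI clinear_tensor_lift_param bil)
       (auto simp: clinear_iff tensor_elem_simps)
  have "cbilinear (\<lambda>s t. tensor_lift
      (\<lambda>(a::'a) (b::'b). tensor_lift (\<lambda>(c::'c) (d::'d). (a \<otimes>\<^sub>e c) \<otimes>\<^sub>e (b \<otimes>\<^sub>e d)) t) s)"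
    unfolding cbilinear_def
    by (intro conjI allI clinear_tensor_lift clinear_tensor_lift_param bil bil2)
  then show ?thesis
    unfolding middle_flip_def by (simp add: bil bil2)
qed


section \<open>Bialgebras\<close>

definition unital_algebra :: "('a::complex_vector \<otimes> 'a \<Rightarrow> 'a) \<Rightarrow> 'a \<Rightarrow> bool"
  where "unital_algebra mul one \<longleftrightarrow> clinear mul
    \<and> mul \<circ> tensor_map mul id = mul \<circ> tensor_map id mul \<circ> tensor_assoc
    \<and> (\<forall>a. mul (one \<otimes>\<^sub>e a) = a) \<and> (\<forall>a. mul (a \<otimes>\<^sub>e one) = a)"

definition coalgebra :: "('a::complex_vector \<Rightarrow> 'a \<otimes> 'a) \<Rightarrow> ('a \<Rightarrow> complex) \<Rightarrow> bool"
  where "coalgebra \<Delta> \<delta> \<longleftrightarrow> clinear \<Delta> \<and> clinear \<delta>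
    \<and> tensor_assoc \<circ> tensor_map \<Delta> id \<circ> \<Delta> = tensor_map id \<Delta> \<circ> \<Delta>
    \<and> tensor_lift (\<lambda>a b. \<delta> a *\<^sub>C b) \<circ> \<Delta> = id
    \<and> tensor_lift (\<lambda>a b. \<delta> b *\<^sub>C a) \<circ> \<Delta> = id"

definition comult_sq :: "('a::complex_vector \<Rightarrow> 'a \<otimes> 'a) \<Rightarrow> 'a \<otimes> 'a \<Rightarrow> ('a \<otimes> 'a) \<otimes> ('a \<otimes> 'a)"
  where "comult_sq \<Delta> = middle_flip \<circ> tensor_map \<Delta> \<Delta>"

definition bialgebra :: "('a::complex_vector \<otimes> 'a \<Rightarrow> 'a) \<Rightarrow> 'a \<Rightarrow>
    ('a \<Rightarrow> 'a \<otimes> 'a) \<Rightarrow> ('a \<Rightarrow> complex) \<Rightarrow> bool"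
  where "bialgebra mul one \<Delta> \<delta> \<longleftrightarrow> unital_algebra mul one \<and> coalgebra \<Delta> \<delta>
    \<and> \<Delta> \<circ> mul = tensor_map mul mul \<circ> comult_sq \<Delta> \<and> \<Delta> one = one \<otimes>\<^sub>e one
    \<and> \<delta> \<circ> mul = functional_tensor \<delta> \<delta> \<and> \<delta> one = 1"

definition cocommutative :: "('a::complex_vector \<Rightarrow> 'a \<otimes> 'a) \<Rightarrow> bool"
  where "cocommutative \<Delta> \<longleftrightarrow> \<Delta> = flip \<circ> \<Delta>"


section \<open>Convolution\<close>

text \<open>
  Convolutions on a coalgebra with comultiplication \<open>D\<close>; they are applied below to the tensor
  square of a bialgebra, i.e. with \<open>D = comult_sq \<Delta>\<close>.
\<close>

definition conv :: "('c::complex_vector \<Rightarrow> 'c \<otimes> 'c) \<Rightarrow> ('c \<Rightarrow> complex) \<Rightarrow> ('c \<Rightarrow> complex)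
    \<Rightarrow> 'c \<Rightarrow> complex"
  where "conv D K L = functional_tensor K L \<circ> D"

definition conv_map_functional :: "('c::complex_vector \<Rightarrow> 'c \<otimes> 'c) \<Rightarrow>
    ('c \<Rightarrow> 'a::complex_vector) \<Rightarrow> ('c \<Rightarrow> complex) \<Rightarrow> 'c \<Rightarrow> 'a"
  where "conv_map_functional D m L = tensor_lift (\<lambda>x y. L y *\<^sub>C m x) \<circ> D"

definition conv_functional_map :: "('c::complex_vector \<Rightarrow> 'c \<otimes> 'c) \<Rightarrow>
    ('c \<Rightarrow> complex) \<Rightarrow> ('c \<Rightarrow> 'a::complex_vector) \<Rightarrow> 'c \<Rightarrow> 'a"
  where "conv_functional_map D L m = tensor_lift (\<lambda>x y. L x *\<^sub>C m y) \<circ> D"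

primrec conv_power :: "('c::complex_vector \<Rightarrow> 'c \<otimes> 'c) \<Rightarrow> ('c \<Rightarrow> complex) \<Rightarrow> ('c \<Rightarrow> complex)
    \<Rightarrow> nat \<Rightarrow> 'c \<Rightarrow> complex" where
  "conv_power D \<epsilon> L 0 = \<epsilon>"
| "conv_power D \<epsilon> L (Suc n) = conv D L (conv_power D \<epsilon> L n)"

text \<open>
  The series converges for every linear functional \<open>L\<close> on a coalgebra \<open>(D, \<epsilon>)\<close>, by the
  fundamental theorem of coalgebras.
\<close>

definition conv_exp :: "('c::complex_vector \<Rightarrow> 'c \<otimes> 'c) \<Rightarrow> ('c \<Rightarrow> complex) \<Rightarrow> real \<Rightarrow>
    ('c \<Rightarrow> complex) \<Rightarrow> 'c \<Rightarrow> complex"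
  where "conv_exp D \<epsilon> t L x =
    suminf (\<lambda>n. complex_of_real t ^ n * conv_power D \<epsilon> L n x / fact n)"


section \<open>Additive deformations\<close>

definition commuting :: "('a::complex_vector \<otimes> 'a \<Rightarrow> 'a) \<Rightarrow> ('a \<Rightarrow> 'a \<otimes> 'a) \<Rightarrow>
    ('a \<otimes> 'a \<Rightarrow> complex) \<Rightarrow> bool"
  where "commuting mul \<Delta> L \<longleftrightarrow>
    conv_map_functional (comult_sq \<Delta>) mul L = conv_functional_map (comult_sq \<Delta>) L mul"

definition normalized :: "'a::complex_vector \<Rightarrow> ('a \<otimes> 'a \<Rightarrow> complex) \<Rightarrow> bool"
  where "normalized one L \<longleftrightarrow> L (one \<otimes>\<^sub>e one) = 0"

definition two_cocycle :: "('a::complex_vector \<otimes> 'a \<Rightarrow> 'a) \<Rightarrow> ('a \<Rightarrow> complex) \<Rightarrow>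
    ('a \<otimes> 'a \<Rightarrow> complex) \<Rightarrow> bool"
  where "two_cocycle mul \<delta> L \<longleftrightarrow> (\<forall>a b c.
    \<delta> a * L (b \<otimes>\<^sub>e c) - L (mul (a \<otimes>\<^sub>e b) \<otimes>\<^sub>e c)
      + L (a \<otimes>\<^sub>e mul (b \<otimes>\<^sub>e c)) - L (a \<otimes>\<^sub>e b) * \<delta> c = 0)"

text \<open>
  Only the values at parameters \<open>t \<ge> 0\<close> are constrained, as in the definition of an additive
  deformation; the extension to all real parameters is given by the exponential formula.
\<close>

definition additive_deformation :: "('a::complex_vector \<otimes> 'a \<Rightarrow> 'a) \<Rightarrow> 'a \<Rightarrow>
    ('a \<Rightarrow> 'a \<otimes> 'a) \<Rightarrow> ('a \<Rightarrow> complex) \<Rightarrow> (real \<Rightarrow> 'a \<otimes> 'a \<Rightarrow> 'a) \<Rightarrow> bool"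
  where "additive_deformation mul one \<Delta> \<delta> \<mu> \<longleftrightarrow>
      (\<forall>t\<ge>0. unital_algebra (\<mu> t) one)
    \<and> \<mu> 0 = mul
    \<and> (\<forall>t\<ge>0. \<forall>s\<ge>0. \<Delta> \<circ> \<mu> (t + s) = tensor_map (\<mu> t) (\<mu> s) \<circ> comult_sq \<Delta>)
    \<and> (\<forall>x. ((\<lambda>t. \<delta> (\<mu> t x)) \<longlongrightarrow> functional_tensor \<delta> \<delta> x) (at_right 0))"

definition deformed_mult :: "('a::complex_vector \<otimes> 'a \<Rightarrow> 'a) \<Rightarrow> ('a \<Rightarrow> 'a \<otimes> 'a) \<Rightarrow>
    ('a \<Rightarrow> complex) \<Rightarrow> ('a \<otimes> 'a \<Rightarrow> complex) \<Rightarrow> real \<Rightarrow> 'a \<otimes> 'a \<Rightarrow> 'a"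
  where "deformed_mult mul \<Delta> \<delta> L t =
    conv_map_functional (comult_sq \<Delta>) mul
      (conv_exp (comult_sq \<Delta>) (functional_tensor \<delta> \<delta>) t L)"

definition antipode_family :: "'a::complex_vector \<Rightarrow> ('a \<Rightarrow> 'a \<otimes> 'a) \<Rightarrow> ('a \<Rightarrow> complex) \<Rightarrow>
    (real \<Rightarrow> 'a \<otimes> 'a \<Rightarrow> 'a) \<Rightarrow> (real \<Rightarrow> 'a \<Rightarrow> 'a) \<Rightarrow> bool"
  where "antipode_family one \<Delta> \<delta> \<mu> S \<longleftrightarrow> (\<forall>t. clinear (S t)
    \<and> \<mu> t \<circ> tensor_map (S t) id \<circ> \<Delta> = (\<lambda>a. \<delta> a *\<^sub>C one)
    \<and> \<mu> t \<circ> tensor_map id (S t) \<circ> \<Delta> = (\<lambda>a. \<delta> a *\<^sub>C one))"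

end

theory Submission
  imports Defs
begin

text \<open>
  Write \<open>e\<^sub>t\<close> for the convolution exponential of \<open>t L\<close>, and \<open>\<Delta>\<^sub>2\<close> for the comultiplication of the
  coalgebra \<open>B \<otimes> B\<close>.

  Each claim about \<open>S\<close> except \<open>S\<^sub>t(1) = 1\<close>, which is the antipode equation at \<open>1\<close>, is an instance
  of the uniqueness of inverses in a convolution monoid (lemma \<open>conv_inverse_unique\<close>): maps from a
  coalgebra to an algebra form a monoid, and one exhibits two maps as a left and a right inverse
  of a third one. The antipode \<open>S\<^sub>t\<close> is the inverse of \<open>id\<close> in the maps \<open>B \<rightarrow> B\<^sub>t\<close>, hence unique;
  \<open>S\<^sub>t \<circ> \<mu>\<^sub>-\<^sub>t\<close> and \<open>\<mu>\<^sub>t \<circ> (S\<^sub>t \<otimes> S\<^sub>t) \<circ> \<tau>\<close> are inverses of \<open>\<mu>\<^sub>t\<close> in the maps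
  \<open>B \<otimes> B \<rightarrow> B\<^sub>t\<close>; \<open>\<Delta> \<circ> S\<^sub>t\<^sub>+\<^sub>r\<close> and \<open>(S\<^sub>t \<otimes> S\<^sub>r) \<circ> \<tau> \<circ> \<Delta>\<close> are inverses of \<open>\<Delta>\<close> in the maps
  \<open>B \<rightarrow> B\<^sub>t \<otimes> B\<^sub>r\<close>; and if \<open>\<Delta>\<close> is cocommutative, then \<open>S\<^sub>t \<circ> S\<^sub>-\<^sub>t\<close> and \<open>id\<close> are inverses of \<open>S\<^sub>t\<close>
  in the maps \<open>B \<rightarrow> B\<^sub>t\<close>.

  These arguments need, for all real parameters, that \<open>\<mu>\<^sub>t\<close> is a unital multiplication and that
  \<open>\<Delta> \<circ> \<mu>\<^sub>t\<^sub>+\<^sub>s = (\<mu>\<^sub>t \<otimes> \<mu>\<^sub>s) \<circ> \<Delta>\<^sub>2\<close>, whereas the definition of an additive deformation provides this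
  only for parameters \<open>\<ge> 0\<close>. The extension has two ingredients. The series \<open>e\<^sub>t\<close> converges for all
  real \<open>t\<close>, because the convolution powers of \<open>L\<close> at a fixed vector grow at most geometrically
  (\<open>conv_power_bound\<close>), and satisfies \<open>e\<^sub>t \<star> e\<^sub>s = e\<^sub>t\<^sub>+\<^sub>s\<close> (\<open>conv_exp_add\<close>). As \<open>e\<^sub>t\<close> commutes with \<open>\<mu>\<close>
  for \<open>t \<ge> 0\<close>, so does its inverse \<open>e\<^sub>-\<^sub>t\<close>, and the second identity follows for all parameters
  (\<open>\<Delta>_\<mu>_add\<close>). Finally, two families that are additive in this sense and agree for \<open>t \<ge> 0\<close> agree
  for all \<open>t\<close> (\<open>additive_family_eq\<close>); applied to the two bracketings of a triple product, and to the
  products with the unit, this gives the algebra axioms.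
\<close>


section \<open>Linear maps out of iterated tensor products\<close>

lemma clinear_id [simp, intro]: "clinear id" "clinear (\<lambda>x. x)"
  by (simp_all add: clinear_iff)

lemma clinear_comp [simp, intro]: "clinear f \<Longrightarrow> clinear g \<Longrightarrow> clinear (f \<circ> g)"
  by (simp add: clinear_iff)

lemma clinear_scaleC_functional [simp, intro]: "clinear f \<Longrightarrow> clinear (\<lambda>x. f x *\<^sub>C v)"
  by (simp add: clinear_iff scaleC_add_left scaleC_scaleC)

lemma clinear_tensor_map [simp, intro]:
  assumes "clinear f" "clinear g"
  shows "clinear (tensor_map f g)"
  unfolding tensor_map_def using assms
  by (intro clinear_tensor_lift) (auto simp: cbilinear_def clinear_iff tensor_elem_simps)

lemma clinear_flip [simp, intro]: "clinear flip"
  unfolding flip_def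
  by (intro clinear_tensor_lift) (auto simp: cbilinear_def clinear_iff tensor_elem_simps)

lemma cbilinear_tensor_assoc_elem:
  "cbilinear (\<lambda>(x::'a::complex_vector) (y::'b::complex_vector). x \<otimes>\<^sub>e (y \<otimes>\<^sub>e (z::'c::complex_vector)))"
  by (auto simp: cbilinear_def clinear_iff tensor_elem_simps)

lemma clinear_tensor_assoc [simp, intro]: "clinear tensor_assoc"
proof -
  have lin: "clinear (\<lambda>z. x \<otimes>\<^sub>e (y \<otimes>\<^sub>e z))"
    for x :: "'a::complex_vector" and y :: "'b::complex_vector"
    by (auto simp: clinear_iff tensor_elem_simps)
  show ?thesis
    unfolding tensor_assoc_def
    by (rule clinear_tensor_lift, unfold cbilinear_def)
       (intro conjI allI clinear_tensor_lift clinear_tensor_lift_param cbilinear_tensor_assoc_elem lin)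
qed

lemma clinear_middle_flip [simp, intro]:
  "clinear (middle_flip :: ('a::complex_vector \<otimes> 'b::complex_vector)
    \<otimes> ('c::complex_vector \<otimes> 'd::complex_vector) \<Rightarrow> _)"
proof -
  have bil: "cbilinear (\<lambda>(c::'c) (d::'d). (a \<otimes>\<^sub>e c) \<otimes>\<^sub>e (b \<otimes>\<^sub>e d))"
    for a :: 'a and b :: 'b
    by (auto simp: cbilinear_def clinear_iff tensor_elem_simps)
  have bil2: "cbilinear (\<lambda>(a::'a) (b::'b). tensor_lift (\<lambda>c d. (a \<otimes>\<^sub>e c) \<otimes>\<^sub>e (b \<otimes>\<^sub>e d)) t)"
    for t :: "'c \<otimes> 'd"
    unfolding cbilinear_def
    by (intro conjI allI clinear_tensor_lift_param bil)
       (auto simp: clinear_iff tensor_elem_simps)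
  show ?thesis
    unfolding middle_flip_def
    by (rule clinear_tensor_lift, unfold cbilinear_def)
       (intro conjI allI clinear_tensor_lift clinear_tensor_lift_param bil bil2)
qed

lemma clinear_slots:
  assumes "clinear f"
  shows "clinear (\<lambda>x. f (x \<otimes>\<^sub>e y))" "clinear (\<lambda>y. f (x \<otimes>\<^sub>e y))"
  using assms by (auto simp: clinear_iff tensor_elem_simps)

lemma tensor_ext_left:
  fixes f g :: "('a::complex_vector \<otimes> 'b::complex_vector) \<otimes> 'c::complex_vector \<Rightarrow> 'd::complex_vector"
  assumes "clinear f" "clinear g"
    and "\<And>x y z. f ((x \<otimes>\<^sub>e y) \<otimes>\<^sub>e z) = g ((x \<otimes>\<^sub>e y) \<otimes>\<^sub>e z)"
  shows "f = g"
  using assms(1,2)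
proof (rule tensor_ext)
  fix s z
  have "(\<lambda>s. f (s \<otimes>\<^sub>e z)) = (\<lambda>s. g (s \<otimes>\<^sub>e z))"
    by (rule tensor_ext) (simp_all add: assms clinear_slots)
  then show "f (s \<otimes>\<^sub>e z) = g (s \<otimes>\<^sub>e z)"
    by (rule fun_cong)
qed

lemma tensor_ext_both:
  fixes f g :: "('a::complex_vector \<otimes> 'b::complex_vector) \<otimes> ('c::complex_vector \<otimes> 'd::complex_vector)
    \<Rightarrow> 'e::complex_vector"
  assumes "clinear f" "clinear g"
    and "\<And>x y z w. f ((x \<otimes>\<^sub>e y) \<otimes>\<^sub>e (z \<otimes>\<^sub>e w)) = g ((x \<otimes>\<^sub>e y) \<otimes>\<^sub>e (z \<otimes>\<^sub>e w))"
  shows "f = g"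
  using assms(1,2)
proof (rule tensor_ext_left)
  fix x y s
  have "(\<lambda>s. f ((x \<otimes>\<^sub>e y) \<otimes>\<^sub>e s)) = (\<lambda>s. g ((x \<otimes>\<^sub>e y) \<otimes>\<^sub>e s))"
    by (rule tensor_ext) (simp_all add: assms clinear_slots)
  then show "f ((x \<otimes>\<^sub>e y) \<otimes>\<^sub>e s) = g ((x \<otimes>\<^sub>e y) \<otimes>\<^sub>e s)"
    by (rule fun_cong)
qed

lemma tensor_map_comp:
  assumes "clinear f" "clinear g" "clinear h" "clinear k"
  shows "tensor_map f g \<circ> tensor_map h k = tensor_map (f \<circ> h) (g \<circ> k)"
  by (rule tensor_ext) (simp_all add: assms tensor_map_elem)

lemma comp_reassoc: "f \<circ> g = h \<Longrightarrow> f \<circ> (g \<circ> k) = h \<circ> k"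
  by (simp flip: comp_assoc)

text \<open>
  Composites are associated to the right and adjacent tensor products of maps are merged; this
  proves the equations that follow from functoriality alone.
\<close>

lemmas tensor_map_comps = comp_assoc tensor_map_comp comp_reassoc[OF tensor_map_comp]

lemma tensor_map_id: "tensor_map id id = id"
  by (rule tensor_ext) (simp_all add: tensor_map_elem)

lemma tensor_map_flip:
  assumes "clinear f" "clinear g"
  shows "tensor_map f g \<circ> flip = flip \<circ> tensor_map g f"
  by (rule tensor_ext) (simp_all add: assms tensor_map_elem flip_elem)

lemma tensor_assoc_natural:
  assumes "clinear f" "clinear g" "clinear h"
  shows "tensor_assoc \<circ> tensor_map (tensor_map f g) h = tensor_map f (tensor_map g h) \<circ> tensor_assoc"
  by (rule tensor_ext_left) (simp_all add: assms tensor_map_elem tensor_assoc_elem)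

lemma middle_flip_natural:
  assumes "clinear f" "clinear g" "clinear h" "clinear k"
  shows "middle_flip \<circ> tensor_map (tensor_map f g) (tensor_map h k)
    = tensor_map (tensor_map f h) (tensor_map g k) \<circ> middle_flip"
  by (rule tensor_ext_both) (simp_all add: assms tensor_map_elem middle_flip_elem)

text \<open>
  Both sides send \<open>((a \<otimes> b) \<otimes> (c \<otimes> d)) \<otimes> (x \<otimes> y)\<close> to
  \<open>(a \<otimes> (c \<otimes> x)) \<otimes> (b \<otimes> (d \<otimes> y))\<close>. This is the coherence behind the fact that tensor products
  of associative algebras are associative.
\<close>

lemma middle_flip_assoc:
  "middle_flip \<circ> tensor_map id middle_flip \<circ> tensor_assoc
    = tensor_map tensor_assoc tensor_assoc \<circ> middle_flip \<circ> tensor_map middle_flip id"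
  (is "?f = ?g")
proof (rule tensor_ext)
  have eq: "(\<lambda>s. ?f (s \<otimes>\<^sub>e (x \<otimes>\<^sub>e y))) = (\<lambda>s. ?g (s \<otimes>\<^sub>e (x \<otimes>\<^sub>e y)))" for x y
    by (rule tensor_ext_both)
       (rule clinear_slots(1)[where f = ?f], simp, rule clinear_slots(1)[where f = ?g], simp,
        simp add: tensor_map_elem middle_flip_elem tensor_assoc_elem)
  show "?f (s \<otimes>\<^sub>e t) = ?g (s \<otimes>\<^sub>e t)" for s t
  proof -
    have "(\<lambda>t. ?f (s \<otimes>\<^sub>e t)) = (\<lambda>t. ?g (s \<otimes>\<^sub>e t))"
      by (rule tensor_ext) (rule clinear_slots(2)[where f = ?f], simp,
          rule clinear_slots(2)[where f = ?g], simp, rule fun_cong[OF eq])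
    then show ?thesis
      by (rule fun_cong)
  qed
qed simp_all

text \<open>The same coherence, in the form needed for tensor products of coalgebras.\<close>

lemma tensor_assoc_middle_flip:
  "tensor_assoc \<circ> tensor_map middle_flip id \<circ> middle_flip
    = tensor_map id middle_flip \<circ> middle_flip \<circ> tensor_map tensor_assoc tensor_assoc"
  (is "?f = ?g")
proof (rule tensor_ext)
  have eq: "(\<lambda>s. ?f (s \<otimes>\<^sub>e ((x \<otimes>\<^sub>e y) \<otimes>\<^sub>e z))) = (\<lambda>s. ?g (s \<otimes>\<^sub>e ((x \<otimes>\<^sub>e y) \<otimes>\<^sub>e z)))" for x y z
    by (rule tensor_ext_left)
       (rule clinear_slots(1)[where f = ?f], simp, rule clinear_slots(1)[where f = ?g], simp,
        simp add: tensor_map_elem middle_flip_elem tensor_assoc_elem)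
  show "?f (s \<otimes>\<^sub>e t) = ?g (s \<otimes>\<^sub>e t)" for s t
  proof -
    have "(\<lambda>t. ?f (s \<otimes>\<^sub>e t)) = (\<lambda>t. ?g (s \<otimes>\<^sub>e t))"
      by (rule tensor_ext_left) (rule clinear_slots(2)[where f = ?f], simp,
          rule clinear_slots(2)[where f = ?g], simp, rule fun_cong[OF eq])
    then show ?thesis
      by (rule fun_cong)
  qed
qed simp_all


section \<open>Convolution with respect to a pairing\<close>

definition left_scalar :: "complex \<otimes> 'a::complex_vector \<Rightarrow> 'a"
  where "left_scalar = tensor_lift (\<lambda>c a. c *\<^sub>C a)"

definition right_scalar :: "'a::complex_vector \<otimes> complex \<Rightarrow> 'a"
  where "right_scalar = tensor_lift (\<lambda>a c. c *\<^sub>C a)"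

lemma cbilinear_scaleC:
  "cbilinear (\<lambda>c a. c *\<^sub>C (a::'a::complex_vector))" "cbilinear (\<lambda>(a::'a) c. c *\<^sub>C a)"
  by (auto simp: cbilinear_def clinear_iff scaleC_add_right scaleC_add_left scaleC_scaleC mult.commute)

lemma clinear_left_scalar [simp, intro]: "clinear left_scalar"
  unfolding left_scalar_def by (rule clinear_tensor_lift[OF cbilinear_scaleC(1)])

lemma clinear_right_scalar [simp, intro]: "clinear right_scalar"
  unfolding right_scalar_def by (rule clinear_tensor_lift[OF cbilinear_scaleC(2)])

lemma left_scalar_elem [simp]: "left_scalar (c \<otimes>\<^sub>e a) = c *\<^sub>C a"
  unfolding left_scalar_def by (simp add: cbilinear_scaleC)

lemma right_scalar_elem [simp]: "right_scalar (a \<otimes>\<^sub>e c) = c *\<^sub>C a"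
  unfolding right_scalar_def by (simp add: cbilinear_scaleC)

lemma clinear_scale: "clinear f \<Longrightarrow> f (c *\<^sub>C x) = c *\<^sub>C f x"
  by (simp add: clinear_iff)

lemma clinear_scale_functional: "clinear f \<Longrightarrow> f (c *\<^sub>C x) = c * f x"
  by (simp add: clinear_iff)

text \<open>
  Keeping the pairing \<open>p\<close> arbitrary treats several operations at once. With \<open>p\<close> the multiplication of an algebra this is the usual convolution product; with the scalar
  multiplications it is the convolution with functionals, and with \<open>p = id\<close> it is
  \<open>(f \<otimes> g) \<circ> D\<close>.
\<close>

definition conv_with :: "('a::complex_vector \<otimes> 'b::complex_vector \<Rightarrow> 'd::complex_vector) \<Rightarrow>
    ('c::complex_vector \<Rightarrow> 'c \<otimes> 'c) \<Rightarrow> ('c \<Rightarrow> 'a) \<Rightarrow> ('c \<Rightarrow> 'b) \<Rightarrow> 'c \<Rightarrow> 'd"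
  where "conv_with p D f g = p \<circ> tensor_map f g \<circ> D"

lemma clinear_conv_with [simp, intro]:
  "clinear p \<Longrightarrow> clinear D \<Longrightarrow> clinear f \<Longrightarrow> clinear g \<Longrightarrow> clinear (conv_with p D f g)"
  by (simp add: conv_with_def)

lemma functional_tensor_eq:
  assumes "clinear K" "clinear L"
  shows "functional_tensor K L = left_scalar \<circ> tensor_map K L"
proof (rule tensor_ext)
  show "clinear (functional_tensor K L)"
    unfolding functional_tensor_def using assms
    by (intro clinear_tensor_lift) (auto simp: cbilinear_def clinear_iff algebra_simps)
qed (simp_all add: assms functional_tensor_elem tensor_map_elem)

lemma clinear_functional_tensor [simp, intro]:
  "clinear K \<Longrightarrow> clinear L \<Longrightarrow> clinear (functional_tensor K L)"
  by (simp add: functional_tensor_eq)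

lemma conv_eq: "clinear K \<Longrightarrow> clinear L \<Longrightarrow> conv D K L = conv_with left_scalar D K L"
  by (simp add: conv_def conv_with_def functional_tensor_eq)

lemma tensor_lift_scaleC_right:
  assumes "clinear m" "clinear L"
  shows "tensor_lift (\<lambda>x y. L y *\<^sub>C m x) = right_scalar \<circ> tensor_map m L"
proof (rule tensor_ext)
  have b: "cbilinear (\<lambda>x y. L y *\<^sub>C m x)"
    using assms by (auto simp: cbilinear_def clinear_iff scaleC_add_left scaleC_add_right
        scaleC_scaleC mult.commute)
  show "clinear (tensor_lift (\<lambda>x y. L y *\<^sub>C m x))"
    by (rule clinear_tensor_lift[OF b])
  show "tensor_lift (\<lambda>x y. L y *\<^sub>C m x) (x \<otimes>\<^sub>e y) = (right_scalar \<circ> tensor_map m L) (x \<otimes>\<^sub>e y)" for x y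
    by (simp add: assms tensor_map_elem b)
qed (simp add: assms)

lemma tensor_lift_scaleC_left:
  assumes "clinear m" "clinear L"
  shows "tensor_lift (\<lambda>x y. L x *\<^sub>C m y) = left_scalar \<circ> tensor_map L m"
proof (rule tensor_ext)
  have b: "cbilinear (\<lambda>x y. L x *\<^sub>C m y)"
    using assms by (auto simp: cbilinear_def clinear_iff scaleC_add_left scaleC_add_right
        scaleC_scaleC mult.commute)
  show "clinear (tensor_lift (\<lambda>x y. L x *\<^sub>C m y))"
    by (rule clinear_tensor_lift[OF b])
  show "tensor_lift (\<lambda>x y. L x *\<^sub>C m y) (x \<otimes>\<^sub>e y) = (left_scalar \<circ> tensor_map L m) (x \<otimes>\<^sub>e y)" for x y
    by (simp add: assms tensor_map_elem b)
qed (simp add: assms)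

lemma conv_map_functional_eq:
  "clinear m \<Longrightarrow> clinear L \<Longrightarrow> conv_map_functional D m L = conv_with right_scalar D m L"
  by (simp add: conv_map_functional_def conv_with_def tensor_lift_scaleC_right)

lemma coalgebra_iff:
  fixes D :: "'a::complex_vector \<Rightarrow> 'a \<otimes> 'a"
  shows "coalgebra D \<epsilon> \<longleftrightarrow> clinear D \<and> clinear \<epsilon>
    \<and> tensor_assoc \<circ> tensor_map D id \<circ> D = tensor_map id D \<circ> D
    \<and> conv_with left_scalar D \<epsilon> id = id \<and> conv_with right_scalar D id \<epsilon> = id"
proof (cases "clinear \<epsilon>")
  case True
  then show ?thesis
    using tensor_lift_scaleC_left[where m = "id :: 'a \<Rightarrow> 'a", OF clinear_id(1) True]
      tensor_lift_scaleC_right[where m = "id :: 'a \<Rightarrow> 'a", OF clinear_id(1) True]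
    by (simp add: coalgebra_def conv_with_def)
qed (simp add: coalgebra_def)

lemma coalgebra_clinear: "coalgebra D \<epsilon> \<Longrightarrow> clinear D" "coalgebra D \<epsilon> \<Longrightarrow> clinear \<epsilon>"
  by (simp_all add: coalgebra_def)

text \<open>
  The one associativity computation: with suitable pairings \<open>p, q, p', q'\<close> it covers products of
  functionals, their actions on maps, and products of maps into an algebra.
\<close>

lemma conv_with_assoc:
  assumes "coalgebra D \<epsilon>"
    and [simp]: "clinear p" "clinear q" "clinear p'" "clinear q'" "clinear f" "clinear g" "clinear h"
    and pq: "\<And>x y z. p (q (x \<otimes>\<^sub>e y) \<otimes>\<^sub>e z) = p' (x \<otimes>\<^sub>e q' (y \<otimes>\<^sub>e z))"
  shows "conv_with p D (conv_with q D f g) h = conv_with p' D f (conv_with q' D g h)"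
proof -
  have [simp]: "clinear D" and coassoc: "tensor_assoc \<circ> tensor_map D id \<circ> D = tensor_map id D \<circ> D"
    using assms(1) by (simp_all add: coalgebra_def)
  have pq': "p \<circ> tensor_map q id = p' \<circ> tensor_map id q' \<circ> tensor_assoc"
    by (rule tensor_ext_left) (simp_all add: tensor_map_elem tensor_assoc_elem pq)
  have "conv_with p D (conv_with q D f g) h
      = (p \<circ> tensor_map q id) \<circ> tensor_map (tensor_map f g) h \<circ> tensor_map D id \<circ> D"
    by (simp add: conv_with_def tensor_map_comps)
  also have "\<dots> = p' \<circ> tensor_map id q' \<circ> (tensor_assoc \<circ> tensor_map (tensor_map f g) h) \<circ> tensor_map D id \<circ> D"
    by (simp only: pq' comp_assoc)
  also have "\<dots> = p' \<circ> tensor_map id q' \<circ> tensor_map f (tensor_map g h) \<circ> (tensor_assoc \<circ> tensor_map D id \<circ> D)"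
    by (simp only: tensor_assoc_natural[OF assms(6-8)] comp_assoc)
  also have "\<dots> = p' \<circ> (tensor_map id q' \<circ> tensor_map f (tensor_map g h) \<circ> tensor_map id D) \<circ> D"
    unfolding coassoc by (simp only: comp_assoc)
  also have "\<dots> = conv_with p' D f (conv_with q' D g h)"
    by (simp add: conv_with_def tensor_map_comps)
  finally show ?thesis .
qed

lemma conv_with_post: "h \<circ> conv_with p D f g = conv_with (h \<circ> p) D f g"
  by (simp add: conv_with_def comp_assoc)

lemma conv_with_maps:
  "clinear a \<Longrightarrow> clinear b \<Longrightarrow> clinear f \<Longrightarrow> clinear g \<Longrightarrow>
    conv_with p D (a \<circ> f) (b \<circ> g) = conv_with (p \<circ> tensor_map a b) D f g"
  by (simp add: conv_with_def tensor_map_comps)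

text \<open>
  For \<open>\<phi> = \<psi> = \<chi>\<close> a morphism of coalgebras this is the usual compatibility with convolution.
  Three different maps are needed for \<open>\<Delta> \<circ> \<mu>\<^sub>t\<^sub>+\<^sub>s = (\<mu>\<^sub>t \<otimes> \<mu>\<^sub>s) \<circ> \<Delta>\<^sub>2\<close>.
\<close>

lemma conv_with_pre:
  "clinear \<phi> \<Longrightarrow> clinear \<psi> \<Longrightarrow> clinear f \<Longrightarrow> clinear g \<Longrightarrow> D \<circ> \<chi> = tensor_map \<phi> \<psi> \<circ> D' \<Longrightarrow>
    conv_with p D f g \<circ> \<chi> = conv_with p D' (f \<circ> \<phi>) (g \<circ> \<psi>)"
  by (simp add: conv_with_def comp_assoc flip: tensor_map_comp)

lemma conv_with_counit_left:
  assumes "coalgebra D \<epsilon>" "clinear f"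
  shows "conv_with left_scalar D \<epsilon> f = f"
proof -
  have [simp]: "clinear D" "clinear \<epsilon>"
    using assms(1) by (simp_all add: coalgebra_def)
  have "left_scalar \<circ> tensor_map id f = f \<circ> left_scalar"
    by (rule tensor_ext) (simp_all add: assms tensor_map_elem clinear_scale)
  then have "conv_with left_scalar D (id \<circ> \<epsilon>) (f \<circ> id) = f \<circ> conv_with left_scalar D \<epsilon> id"
    by (simp only: conv_with_post) (subst conv_with_maps; simp add: assms)
  then show ?thesis
    using assms(1) by (simp add: coalgebra_iff)
qed

lemma conv_with_counit_right:
  assumes "coalgebra D \<epsilon>" "clinear f"
  shows "conv_with right_scalar D f \<epsilon> = f"
proof -
  have [simp]: "clinear D" "clinear \<epsilon>"
    using assms(1) by (simp_all add: coalgebra_def)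
  have "right_scalar \<circ> tensor_map f id = f \<circ> right_scalar"
    by (rule tensor_ext) (simp_all add: assms tensor_map_elem clinear_scale)
  then have "conv_with right_scalar D (f \<circ> id) (id \<circ> \<epsilon>) = f \<circ> conv_with right_scalar D id \<epsilon>"
    by (simp only: conv_with_post) (subst conv_with_maps; simp add: assms)
  then show ?thesis
    using assms(1) by (simp add: coalgebra_iff)
qed


section \<open>Tensor products of coalgebras and algebras\<close>

definition tensor_comult :: "('c::complex_vector \<Rightarrow> 'c \<otimes> 'c) \<Rightarrow> ('d::complex_vector \<Rightarrow> 'd \<otimes> 'd) \<Rightarrow>
    'c \<otimes> 'd \<Rightarrow> ('c \<otimes> 'd) \<otimes> ('c \<otimes> 'd)"
  where "tensor_comult D E = middle_flip \<circ> tensor_map D E"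

lemma comult_sq_eq: "comult_sq \<Delta> = tensor_comult \<Delta> \<Delta>"
  by (simp add: comult_sq_def tensor_comult_def)

lemma clinear_tensor_comult [simp, intro]:
  "clinear D \<Longrightarrow> clinear E \<Longrightarrow> clinear (tensor_comult D E)"
  by (simp add: tensor_comult_def)

lemma coalgebra_tensor:
  assumes "coalgebra D \<epsilon>" "coalgebra E \<eta>"
  shows "coalgebra (tensor_comult D E) (functional_tensor \<epsilon> \<eta>)"
proof -
  let ?C = "tensor_comult D E"
  have [simp]: "clinear D" "clinear \<epsilon>" "clinear E" "clinear \<eta>"
    using assms by (simp_all add: coalgebra_def)
  have [simp]: "tensor_assoc \<circ> (tensor_map D id \<circ> D) = tensor_map id D \<circ> D"
    "tensor_assoc \<circ> (tensor_map E id \<circ> E) = tensor_map id E \<circ> E"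
    using assms by (simp_all add: coalgebra_def comp_assoc)
  have "tensor_assoc \<circ> tensor_map ?C id \<circ> ?C
      = tensor_assoc \<circ> tensor_map middle_flip id
        \<circ> (tensor_map (tensor_map D E) (tensor_map id id) \<circ> middle_flip) \<circ> tensor_map D E"
    by (simp add: tensor_comult_def tensor_map_id tensor_map_comps)
  also have "\<dots> = (tensor_assoc \<circ> tensor_map middle_flip id \<circ> middle_flip)
        \<circ> tensor_map (tensor_map D id \<circ> D) (tensor_map E id \<circ> E)"
    by (simp add: middle_flip_natural[symmetric] tensor_map_comps)
  also have "\<dots> = tensor_map id middle_flip \<circ> middle_flip
        \<circ> tensor_map (tensor_map id D \<circ> D) (tensor_map id E \<circ> E)"
    unfolding tensor_assoc_middle_flip by (simp add: tensor_map_comps)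
  also have "\<dots> = tensor_map id middle_flip
        \<circ> (tensor_map (tensor_map id id) (tensor_map D E) \<circ> middle_flip) \<circ> tensor_map D E"
    by (simp add: middle_flip_natural[symmetric] tensor_map_comps)
  also have "\<dots> = tensor_map id ?C \<circ> ?C"
    by (simp add: tensor_comult_def tensor_map_id tensor_map_comps)
  finally have coassoc: "tensor_assoc \<circ> tensor_map ?C id \<circ> ?C = tensor_map id ?C \<circ> ?C" .
  have "left_scalar \<circ> tensor_map (functional_tensor \<epsilon> \<eta>) id \<circ> middle_flip
      = tensor_map (left_scalar \<circ> tensor_map \<epsilon> id) (left_scalar \<circ> tensor_map \<eta> id)"
    by (rule tensor_ext_both)
       (simp_all add: middle_flip_elem tensor_map_elem functional_tensor_elem tensor_elem_simps scaleC_scaleC mult.commute)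
  from arg_cong[where f = "\<lambda>h. h \<circ> tensor_map D E", OF this]
  have "conv_with left_scalar ?C (functional_tensor \<epsilon> \<eta>) id
      = tensor_map (conv_with left_scalar D \<epsilon> id) (conv_with left_scalar E \<eta> id)"
    by (simp add: conv_with_def tensor_comult_def tensor_map_comps)
  then have left: "conv_with left_scalar ?C (functional_tensor \<epsilon> \<eta>) id = id"
    using assms by (simp add: coalgebra_iff tensor_map_id)
  have "right_scalar \<circ> tensor_map id (functional_tensor \<epsilon> \<eta>) \<circ> middle_flip
      = tensor_map (right_scalar \<circ> tensor_map id \<epsilon>) (right_scalar \<circ> tensor_map id \<eta>)"
    by (rule tensor_ext_both)
       (simp_all add: middle_flip_elem tensor_map_elem functional_tensor_elem tensor_elem_simps scaleC_scaleC mult.commute)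
  from arg_cong[where f = "\<lambda>h. h \<circ> tensor_map D E", OF this]
  have "conv_with right_scalar ?C id (functional_tensor \<epsilon> \<eta>)
      = tensor_map (conv_with right_scalar D id \<epsilon>) (conv_with right_scalar E id \<eta>)"
    by (simp add: conv_with_def tensor_comult_def tensor_map_comps)
  then have right: "conv_with right_scalar ?C id (functional_tensor \<epsilon> \<eta>) = id"
    using assms by (simp add: coalgebra_iff tensor_map_id)
  show ?thesis
    by (simp add: coalgebra_iff coassoc left right)
qed

lemma unital_algebra_tensor:
  assumes "unital_algebra m u" "unital_algebra n v"
  shows "unital_algebra (tensor_map m n \<circ> middle_flip) (u \<otimes>\<^sub>e v)"
proof -
  let ?p = "tensor_map m n \<circ> middle_flip"
  have [simp]: "clinear m" "clinear n"
    using assms by (simp_all add: unital_algebra_def)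
  have am: "m \<circ> tensor_map m id = m \<circ> tensor_map id m \<circ> tensor_assoc"
    and an: "n \<circ> tensor_map n id = n \<circ> tensor_map id n \<circ> tensor_assoc"
    using assms by (simp_all add: unital_algebra_def)
  have "?p \<circ> tensor_map ?p id
      = tensor_map m n \<circ> (middle_flip \<circ> tensor_map (tensor_map m n) (tensor_map id id)) \<circ> tensor_map middle_flip id"
    by (simp add: tensor_map_comps tensor_map_id)
  also have "\<dots> = tensor_map (m \<circ> tensor_map m id) (n \<circ> tensor_map n id) \<circ> middle_flip \<circ> tensor_map middle_flip id"
    by (simp add: middle_flip_natural tensor_map_comps)
  also have "\<dots> = tensor_map (m \<circ> tensor_map id m) (n \<circ> tensor_map id n)
      \<circ> (tensor_map tensor_assoc tensor_assoc \<circ> middle_flip \<circ> tensor_map middle_flip id)"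
    unfolding am an by (simp add: tensor_map_comps)
  also have "\<dots> = tensor_map m n \<circ> (tensor_map (tensor_map id m) (tensor_map id n) \<circ> middle_flip)
      \<circ> tensor_map id middle_flip \<circ> tensor_assoc"
    unfolding middle_flip_assoc[symmetric] by (simp add: tensor_map_comps)
  also have "\<dots> = tensor_map m n \<circ> (middle_flip \<circ> tensor_map (tensor_map id id) (tensor_map m n))
      \<circ> tensor_map id middle_flip \<circ> tensor_assoc"
    by (simp add: middle_flip_natural)
  also have "\<dots> = ?p \<circ> tensor_map id ?p \<circ> tensor_assoc"
    by (simp add: tensor_map_comps tensor_map_id)
  finally have assoc: "?p \<circ> tensor_map ?p id = ?p \<circ> tensor_map id ?p \<circ> tensor_assoc" .
  have "(\<lambda>a. ?p ((u \<otimes>\<^sub>e v) \<otimes>\<^sub>e a)) = id"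
    by (rule tensor_ext, rule clinear_slots(2)[where f = ?p])
       (use assms in \<open>simp_all add: middle_flip_elem tensor_map_elem unital_algebra_def\<close>)
  moreover have "(\<lambda>a. ?p (a \<otimes>\<^sub>e (u \<otimes>\<^sub>e v))) = id"
    by (rule tensor_ext, rule clinear_slots(1)[where f = ?p])
       (use assms in \<open>simp_all add: middle_flip_elem tensor_map_elem unital_algebra_def\<close>)
  ultimately show ?thesis
    unfolding unital_algebra_def using assoc by (simp add: fun_eq_iff)
qed


section \<open>Convolution exponentials\<close>

text \<open>
  As a rewrite rule this equation would also rewrite the scalar multiplication inside the
  predicate \<open>clinear\<close> for functionals.
\<close>

declare scaleC_complex_eq [simp del]

lemma coalgebra_conv_assoc:
  assumes "coalgebra D \<epsilon>" "clinear f" "clinear g" "clinear h"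
  shows "conv_with left_scalar D (conv_with left_scalar D f g) h
    = conv_with left_scalar D f (conv_with left_scalar D g h)"
  by (rule conv_with_assoc[OF assms(1)])
     (simp_all add: assms scaleC_scaleC scaleC_complex_eq)

lemma clinear_conv_power [simp, intro]:
  assumes "coalgebra D \<epsilon>" "clinear L"
  shows "clinear (conv_power D \<epsilon> L n)"
  by (induction n) (use assms in \<open>simp_all add: conv_eq coalgebra_clinear\<close>)

lemma conv_power_add:
  assumes "coalgebra D \<epsilon>" "clinear L"
  shows "conv_with left_scalar D (conv_power D \<epsilon> L m) (conv_power D \<epsilon> L n) = conv_power D \<epsilon> L (m + n)"
proof (induction m)
  case 0
  then show ?case
    using assms by (simp add: conv_with_counit_left)
next
  case (Suc m)
  then show ?case
    using assms by (simp add: conv_eq coalgebra_conv_assoc)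
qed

lemma conv_with_eval:
  assumes "clinear p" "clinear f" "clinear g" "D x = (\<Sum>k\<in>A. c k *\<^sub>C (fst k \<otimes>\<^sub>e snd k))"
  shows "conv_with p D f g x = (\<Sum>k\<in>A. c k *\<^sub>C p (f (fst k) \<otimes>\<^sub>e g (snd k)))"
  using assms by (simp add: conv_with_def clinear_sum[where f = p] clinear_sum[OF clinear_tensor_map]
      clinear_scale clinear_scale[OF clinear_tensor_map] tensor_map_elem)

text \<open>
  Let \<open>T y = L(y\<^sub>1) y\<^sub>2\<close>; then the convolution power \<open>L\<^sup>n\<close> is \<open>\<epsilon> \<circ> T\<^sup>n\<close>. The set \<open>W\<close> of all vectors
  \<open>f(x\<^sub>1) x\<^sub>2\<close>, with \<open>f\<close> a linear functional, contains \<open>x\<close> (take \<open>f = \<epsilon>\<close>), is mapped into itself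
  by \<open>T\<close> (which replaces \<open>f\<close> by \<open>f \<star> L\<close>), and lies in the span of the right-hand factors of one
  expansion of \<open>D x\<close>. So the values \<open>L\<^sup>n(x)\<close> are linear combinations of the entries of the powers of
  one finite matrix, with coefficients independent of \<open>n\<close>, and grow at most geometrically.
\<close>

lemma conv_power_bound:
  fixes D :: "'c::complex_vector \<Rightarrow> 'c \<otimes> 'c"
  assumes co: "coalgebra D \<epsilon>" and [simp]: "clinear L"
  obtains K M where "\<And>n. cmod (conv_power D \<epsilon> L n x) \<le> K * M ^ n" "K \<ge> 0" "M \<ge> 0"
proof -
  have [simp]: "clinear D" "clinear \<epsilon>"
    using co by (simp_all add: coalgebra_clinear)
  define T where "T = conv_with left_scalar D L id"
  let ?P = "conv_power D \<epsilon> L"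
  have P_lin [simp]: "clinear (?P n)" for n
    using co by simp
  have P_Suc: "?P (Suc n) y = ?P n (T y)" for n y
  proof -
    have "?P n \<circ> left_scalar = left_scalar \<circ> tensor_map id (?P n)"
      by (rule tensor_ext) (simp_all add: tensor_map_elem clinear_scale)
    then have "?P n \<circ> T = conv_with left_scalar D (id \<circ> L) (?P n \<circ> id)"
      unfolding T_def conv_with_post by (subst conv_with_maps) simp_all
    then show ?thesis
      by (simp add: conv_eq fun_eq_iff)
  qed
  define W where "W = {conv_with left_scalar D f id x |f. clinear f}"
  have x_W: "x \<in> W"
    unfolding W_def using co by (auto simp: conv_with_counit_left intro!: exI[of _ \<epsilon>])
  have T_W: "T y \<in> W" if y_W: "y \<in> W" for y
  proof -
    obtain f where [simp]: "clinear f" and y: "y = conv_with left_scalar D f id x"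
      using y_W by (auto simp: W_def)
    have "T \<circ> left_scalar = left_scalar \<circ> tensor_map id T"
      by (rule tensor_ext) (simp_all add: T_def tensor_map_elem clinear_scale)
    then have "T \<circ> conv_with left_scalar D f id = conv_with left_scalar D (id \<circ> f) (T \<circ> id)"
      unfolding conv_with_post by (subst conv_with_maps) (simp_all add: T_def)
    also have "\<dots> = conv_with left_scalar D (conv_with left_scalar D f L) id"
      by (simp add: T_def coalgebra_conv_assoc[OF co])
    finally show ?thesis
      unfolding W_def y by (auto simp: fun_eq_iff intro!: exI[of _ "conv_with left_scalar D f L"])
  qed
  obtain p where p: "D x = (\<Sum>k\<in>Poly_Mapping.keys p. Poly_Mapping.lookup p k *\<^sub>C (fst k \<otimes>\<^sub>e snd k))"
    by (rule tensor_sum_elems)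
  have W_span: "W \<subseteq> cvs.span (snd ` Poly_Mapping.keys p)"
    unfolding W_def
    by (clarsimp simp: conv_with_eval[where D = D and x = x, OF _ _ _ p])
       (intro cvs.span_sum cvs.span_scale cvs.span_base imageI)
  obtain B where B: "B \<subseteq> W" "cvs.independent B" "W \<subseteq> cvs.span B"
    by (rule cvs.maximal_independent_subset)
  have fin: "finite B"
    using cvs.independent_span_bound[OF _ B(2), of "snd ` Poly_Mapping.keys p"] B(1) W_span by auto
  have expand: "\<exists>u. y = (\<Sum>b\<in>B. u b *\<^sub>C b)" if "y \<in> W" for y
    using that B(3) by (auto simp: cvs.span_finite[OF fin])
  then have "\<forall>b\<in>B. \<exists>u. T b = (\<Sum>b'\<in>B. u b' *\<^sub>C b')"
    using B(1) T_W by blast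
  then obtain a where a: "\<And>b. b \<in> B \<Longrightarrow> T b = (\<Sum>b'\<in>B. a b b' *\<^sub>C b')"
    by metis
  obtain u where u: "x = (\<Sum>b\<in>B. u b *\<^sub>C b)"
    using expand[OF x_W] by blast
  define K where "K = (\<Sum>b\<in>B. cmod (\<epsilon> b))"
  define M where "M = (\<Sum>b\<in>B. \<Sum>b'\<in>B. cmod (a b b'))"
  have [simp]: "K \<ge> 0" "M \<ge> 0"
    by (simp_all add: K_def M_def sum_nonneg)
  have bound: "cmod (?P n b) \<le> K * M ^ n" if "b \<in> B" for n b
    using that
  proof (induction n arbitrary: b)
    case 0
    then show ?case
      using fin by (auto simp: K_def intro!: member_le_sum)
  next
    case (Suc n)
    have "cmod (?P (Suc n) b) = cmod (\<Sum>b'\<in>B. a b b' * ?P n b')"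
      unfolding P_Suc a[OF Suc.prems] by (simp add: clinear_sum clinear_scale_functional)
    also have "\<dots> \<le> (\<Sum>b'\<in>B. cmod (a b b') * (K * M ^ n))"
      by (rule order.trans[OF norm_sum], rule sum_mono) (auto simp: norm_mult intro!: mult_left_mono Suc.IH)
    also have "\<dots> = (\<Sum>b'\<in>B. cmod (a b b')) * (K * M ^ n)"
      by (simp add: sum_distrib_right)
    also have "\<dots> \<le> M * (K * M ^ n)"
      unfolding M_def
      by (intro mult_right_mono member_le_sum[where f = "\<lambda>b. \<Sum>b'\<in>B. cmod (a b b')"])
         (use Suc.prems fin in \<open>auto simp: K_def sum_nonneg\<close>)
    finally show ?case
      by (simp add: mult_ac)
  qed
  show thesis
  proof (rule that)
    fix n
    have "cmod (?P n x) = cmod (\<Sum>b\<in>B. u b * ?P n b)"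
      by (subst u) (simp add: clinear_sum clinear_scale_functional)
    also have "\<dots> \<le> (\<Sum>b\<in>B. cmod (u b) * (K * M ^ n))"
      by (rule order.trans[OF norm_sum], rule sum_mono) (auto simp: norm_mult intro!: mult_left_mono bound)
    also have "\<dots> = ((\<Sum>b\<in>B. cmod (u b)) * K) * M ^ n"
      by (simp add: sum_distrib_right mult.assoc)
    finally show "cmod (?P n x) \<le> ((\<Sum>b\<in>B. cmod (u b)) * K) * M ^ n" .
  qed (simp_all add: sum_nonneg)
qed

lemma summable_norm_conv_exp:
  assumes "coalgebra D \<epsilon>" "clinear L"
  shows "summable (\<lambda>n. cmod (complex_of_real t ^ n * conv_power D \<epsilon> L n x / fact n))"
proof -
  obtain K M where bound: "\<And>n. cmod (conv_power D \<epsilon> L n x) \<le> K * M ^ n" "K \<ge> 0" "M \<ge> 0"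
    using conv_power_bound[OF assms] by metis
  show ?thesis
  proof (rule summable_comparison_test)
    show "summable (\<lambda>n. K * (inverse (fact n) * (\<bar>t\<bar> * M) ^ n))"
      by (intro summable_mult summable_exp)
    show "\<exists>N. \<forall>n\<ge>N. norm (cmod (complex_of_real t ^ n * conv_power D \<epsilon> L n x / fact n))
        \<le> K * (inverse (fact n) * (\<bar>t\<bar> * M) ^ n)"
    proof (intro exI allI impI)
      fix n :: nat
      have "\<bar>t\<bar> ^ n * cmod (conv_power D \<epsilon> L n x) / fact n \<le> \<bar>t\<bar> ^ n * (K * M ^ n) / fact n"
        by (intro divide_right_mono mult_left_mono bound) auto
      then show "norm (cmod (complex_of_real t ^ n * conv_power D \<epsilon> L n x / fact n))
          \<le> K * (inverse (fact n) * (\<bar>t\<bar> * M) ^ n)"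
        by (simp add: norm_mult norm_divide norm_power power_mult_distrib field_simps)
    qed
  qed
qed

lemma conv_exp_sums:
  assumes "coalgebra D \<epsilon>" "clinear L"
  shows "(\<lambda>n. complex_of_real t ^ n * conv_power D \<epsilon> L n x / fact n) sums conv_exp D \<epsilon> t L x"
  unfolding conv_exp_def
  by (rule summable_sums[OF summable_norm_cancel[OF summable_norm_conv_exp[OF assms]]])

lemma clinear_conv_exp [simp, intro]:
  assumes "coalgebra D \<epsilon>" "clinear L"
  shows "clinear (conv_exp D \<epsilon> t L)"
  unfolding clinear_iff
proof (intro conjI allI)
  have lin: "clinear (conv_power D \<epsilon> L n)" for n
    using assms by simp
  note s = conv_exp_sums[OF assms, of t]
  fix x y c
  show "conv_exp D \<epsilon> t L (x + y) = conv_exp D \<epsilon> t L x + conv_exp D \<epsilon> t L y"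
    using sums_add[OF s[of x] s[of y]] lin
    by (intro sums_unique2[OF s]) (simp add: clinear_iff ring_distribs add_divide_distrib)
  show "conv_exp D \<epsilon> t L (c *\<^sub>C x) = c *\<^sub>C conv_exp D \<epsilon> t L x"
    using sums_mult[OF s[of x], of c] lin
    by (intro sums_unique2[OF s]) (simp add: clinear_iff scaleC_complex_eq mult_ac)
qed

lemma conv_exp_zero: "conv_exp D \<epsilon> 0 L = \<epsilon>"
proof
  fix x
  have "conv_exp D \<epsilon> 0 L x = suminf (\<lambda>n. if n = 0 then \<epsilon> x else 0)"
    unfolding conv_exp_def by (rule arg_cong[where f = suminf]) (auto simp: fun_eq_iff)
  then show "conv_exp D \<epsilon> 0 L x = \<epsilon> x"
    using suminf_finite[of "{0}" "\<lambda>n. if n = 0 then \<epsilon> x else 0"] by simp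
qed

text \<open>
  Expand \<open>D x\<close> as a finite sum; the Cauchy product of the two series then has the terms
  \<open>(t + s)\<^sup>n L\<^sup>n(x) / n!\<close> by the binomial theorem.
\<close>

lemma conv_exp_add:
  assumes "coalgebra D \<epsilon>" "clinear L"
  shows "conv_with left_scalar D (conv_exp D \<epsilon> t L) (conv_exp D \<epsilon> s L) = conv_exp D \<epsilon> (t + s) L"
proof
  fix x
  let ?P = "conv_power D \<epsilon> L"
  define a where "a r n y = complex_of_real r ^ n * ?P n y / fact n" for r n y
  have lin [simp]: "clinear (?P n)" "clinear (conv_exp D \<epsilon> r L)" for n r
    using assms by simp_all
  obtain p where p: "D x = (\<Sum>k\<in>Poly_Mapping.keys p. Poly_Mapping.lookup p k *\<^sub>C (fst k \<otimes>\<^sub>e snd k))"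
    by (rule tensor_sum_elems)
  let ?A = "Poly_Mapping.keys p" and ?c = "Poly_Mapping.lookup p"
  have exp_suminf: "suminf (\<lambda>n. a r n y) = conv_exp D \<epsilon> r L y" for r y
    by (simp add: a_def conv_exp_def)
  have "(\<lambda>n. \<Sum>i\<le>n. a t i y * a s (n - i) z) sums (conv_exp D \<epsilon> t L y * conv_exp D \<epsilon> s L z)" for y z
    using Cauchy_product_sums[of "\<lambda>n. a t n y" "\<lambda>n. a s n z"] summable_norm_conv_exp[OF assms]
    by (simp add: exp_suminf) (simp add: a_def)
  then have "(\<lambda>n. \<Sum>k\<in>?A. ?c k * (\<Sum>i\<le>n. a t i (fst k) * a s (n - i) (snd k)))
      sums (\<Sum>k\<in>?A. ?c k * (conv_exp D \<epsilon> t L (fst k) * conv_exp D \<epsilon> s L (snd k)))"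
    by (intro sums_sum sums_mult)
  moreover have "(\<Sum>k\<in>?A. ?c k * (\<Sum>i\<le>n. a t i (fst k) * a s (n - i) (snd k)))
      = complex_of_real (t + s) ^ n * ?P n x / fact n" for n
  proof -
    have "(\<Sum>k\<in>?A. ?c k * (\<Sum>i\<le>n. a t i (fst k) * a s (n - i) (snd k)))
        = (\<Sum>i\<le>n. complex_of_real t ^ i * complex_of_real s ^ (n - i) / (fact i * fact (n - i))
            * (\<Sum>k\<in>?A. ?c k * (?P i (fst k) * ?P (n - i) (snd k))))"
      unfolding sum_distrib_left
      by (subst sum.swap) (simp add: a_def field_simps)
    also have "\<dots> = (\<Sum>i\<le>n. complex_of_real t ^ i * complex_of_real s ^ (n - i) / (fact i * fact (n - i)) * ?P n x)"
    proof (rule sum.cong[OF refl])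
      fix i assume "i \<in> {..n}"
      then have "(\<Sum>k\<in>?A. ?c k * (?P i (fst k) * ?P (n - i) (snd k))) = ?P n x"
        using conv_power_add[OF assms, of i "n - i"]
          conv_with_eval[where D = D and x = x, OF clinear_left_scalar lin(1) lin(1) p, of i "n - i"]
        by (simp add: scaleC_complex_eq mult.assoc)
      then show "complex_of_real t ^ i * complex_of_real s ^ (n - i) / (fact i * fact (n - i))
            * (\<Sum>k\<in>?A. ?c k * (?P i (fst k) * ?P (n - i) (snd k)))
          = complex_of_real t ^ i * complex_of_real s ^ (n - i) / (fact i * fact (n - i)) * ?P n x"
        by simp
    qed
    also have "\<dots> = complex_of_real (t + s) ^ n * ?P n x / fact n"
      by (simp add: binomial_ring sum_distrib_right sum_divide_distrib)
         (rule sum.cong, auto simp: binomial_fact field_simps)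
    finally show ?thesis .
  qed
  ultimately have "(\<lambda>n. complex_of_real (t + s) ^ n * ?P n x / fact n)
      sums (\<Sum>k\<in>?A. ?c k * (conv_exp D \<epsilon> t L (fst k) * conv_exp D \<epsilon> s L (snd k)))"
    by simp
  then have "conv_exp D \<epsilon> (t + s) L x
      = (\<Sum>k\<in>?A. ?c k * (conv_exp D \<epsilon> t L (fst k) * conv_exp D \<epsilon> s L (snd k)))"
    by (rule sums_unique2[OF conv_exp_sums[OF assms]])
  then show "conv_with left_scalar D (conv_exp D \<epsilon> t L) (conv_exp D \<epsilon> s L) x = conv_exp D \<epsilon> (t + s) L x"
    by (simp add: conv_with_eval[where D = D and x = x, OF clinear_left_scalar lin(2) lin(2) p]
        scaleC_complex_eq)
qed


section \<open>Additive families on the whole real line\<close>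

text \<open>
  Composing with the counit \<open>\<delta>\<close> turns each family into a one-parameter convolution group of
  functionals, so that the functionals at \<open>t\<close> and \<open>- t\<close> are inverse to each other. Equality at
  \<open>t \<ge> 0\<close> therefore forces equality of the inverses at \<open>- t\<close>, and the map is recovered from its
  functional as \<open>A\<^sub>t = A\<^sub>0 \<star> (\<delta> \<circ> A\<^sub>t)\<close>. In this way the algebra axioms pass from \<open>t \<ge> 0\<close> to all
  real \<open>t\<close> by pure algebra.
\<close>

lemma additive_family_eq:
  fixes D :: "'c::complex_vector \<Rightarrow> 'c \<otimes> 'c" and \<Delta> :: "'b::complex_vector \<Rightarrow> 'b \<otimes> 'b"
    and A A' :: "real \<Rightarrow> 'c \<Rightarrow> 'b"
  assumes co: "coalgebra D \<epsilon>" "coalgebra \<Delta> \<delta>"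
    and lin [simp]: "\<And>t. clinear (A t)" "\<And>t. clinear (A' t)"
    and add: "\<And>t s. \<Delta> \<circ> A (t + s) = tensor_map (A t) (A s) \<circ> D"
    and add': "\<And>t s. \<Delta> \<circ> A' (t + s) = tensor_map (A' t) (A' s) \<circ> D"
    and zero: "\<delta> \<circ> A 0 = \<epsilon>"
    and eq: "\<And>t. t \<ge> 0 \<Longrightarrow> A t = A' t"
  shows "A t = A' t"
proof -
  have [simp]: "clinear D" "clinear \<epsilon>" "clinear \<Delta>" "clinear \<delta>"
    using co by (simp_all add: coalgebra_clinear)
  have group: "conv_with left_scalar D (\<delta> \<circ> F t) (\<delta> \<circ> F s) = \<delta> \<circ> F (t + s)"
    if "\<And>t. clinear (F t)" "\<And>t s. \<Delta> \<circ> F (t + s) = tensor_map (F t) (F s) \<circ> D"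
    for F :: "real \<Rightarrow> 'c \<Rightarrow> 'b" and t s
  proof -
    have "conv_with left_scalar \<Delta> \<delta> \<delta> \<circ> F (t + s) = conv_with left_scalar D (\<delta> \<circ> F t) (\<delta> \<circ> F s)"
      using that by (intro conv_with_pre) simp_all
    then show ?thesis
      by (simp add: conv_with_counit_left[OF co(2)])
  qed
  have same: "\<delta> \<circ> A t = \<delta> \<circ> A' t"
  proof (cases "t \<ge> 0")
    case False
    then have opp: "A (- t) = A' (- t)"
      by (simp add: eq)
    have "\<delta> \<circ> A t = conv_with left_scalar D (\<delta> \<circ> A t) (conv_with left_scalar D (\<delta> \<circ> A' (- t)) (\<delta> \<circ> A' t))"
      using group[of A', OF lin(2) add', of "- t" t] group[of A, OF lin(1) add, of t 0] eq[of 0] zero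
      by simp
    also have "\<dots> = conv_with left_scalar D (conv_with left_scalar D (\<delta> \<circ> A t) (\<delta> \<circ> A (- t))) (\<delta> \<circ> A' t)"
      by (simp add: opp coalgebra_conv_assoc[OF co(1)])
    also have "\<dots> = \<delta> \<circ> A' t"
      using group[of A, OF lin(1) add, of t "- t"] zero by (simp add: conv_with_counit_left[OF co(1)])
    finally show ?thesis .
  qed (simp add: eq)
  have recover: "F t = conv_with right_scalar D (F 0) (\<delta> \<circ> F t)"
    if "\<And>t. clinear (F t)" "\<And>t s. \<Delta> \<circ> F (t + s) = tensor_map (F t) (F s) \<circ> D"
    for F :: "real \<Rightarrow> 'c \<Rightarrow> 'b"
  proof -
    have "conv_with right_scalar \<Delta> id \<delta> \<circ> F (0 + t) = conv_with right_scalar D (id \<circ> F 0) (\<delta> \<circ> F t)"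
      by (intro conv_with_pre) (simp_all only: that clinear_id(1) \<open>clinear \<delta>\<close>)
    then show ?thesis
      by (simp add: conv_with_counit_right[OF co(2)])
  qed
  show ?thesis
    using recover[of A, OF lin(1) add] recover[of A', OF lin(2) add'] same eq[of 0] by simp
qed


section \<open>Deformed multiplications for all real parameters\<close>

locale deformed_bialgebra =
  fixes mul :: "'b::complex_vector \<otimes> 'b \<Rightarrow> 'b" and one :: 'b
    and \<Delta> :: "'b \<Rightarrow> 'b \<otimes> 'b" and \<delta> :: "'b \<Rightarrow> complex"
    and L :: "'b \<otimes> 'b \<Rightarrow> complex" and \<mu> :: "real \<Rightarrow> 'b \<otimes> 'b \<Rightarrow> 'b"
  assumes bialgebra: "bialgebra mul one \<Delta> \<delta>"
    and deformation: "additive_deformation mul one \<Delta> \<delta> \<mu>"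
    and clinear_L: "clinear L"
    and \<mu>_deformed: "\<And>t. \<mu> t = deformed_mult mul \<Delta> \<delta> L t"
begin

abbreviation exp_L :: "real \<Rightarrow> 'b \<otimes> 'b \<Rightarrow> complex"
  where "exp_L t \<equiv> conv_exp (comult_sq \<Delta>) (functional_tensor \<delta> \<delta>) t L"

lemma coalgebra: "coalgebra \<Delta> \<delta>" and coalgebra_sq: "coalgebra (comult_sq \<Delta>) (functional_tensor \<delta> \<delta>)"
  using bialgebra by (simp_all add: bialgebra_def comult_sq_eq coalgebra_tensor)

lemma clinear_structure [simp]:
  "clinear mul" "clinear \<Delta>" "clinear \<delta>" "clinear (comult_sq \<Delta>)" "clinear (exp_L t)"
  using bialgebra coalgebra coalgebra_sq clinear_L
  by (simp_all add: bialgebra_def unital_algebra_def coalgebra_clinear)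

lemma \<Delta>_mul: "\<Delta> \<circ> mul = tensor_map mul mul \<circ> comult_sq \<Delta>"
  and \<delta>_mul: "\<delta> \<circ> mul = functional_tensor \<delta> \<delta>"
  and \<Delta>_one: "\<Delta> one = one \<otimes>\<^sub>e one" and \<delta>_one: "\<delta> one = 1"
  using bialgebra by (simp_all add: bialgebra_def)

lemma \<mu>_eq: "\<mu> t = conv_with right_scalar (comult_sq \<Delta>) mul (exp_L t)"
  by (simp add: \<mu>_deformed deformed_mult_def conv_map_functional_eq)

lemma clinear_\<mu> [simp]: "clinear (\<mu> t)"
  by (simp add: \<mu>_eq)

lemma \<mu>_zero: "\<mu> 0 = mul"
  using deformation by (simp add: additive_deformation_def)

lemma exp_L_add: "conv_with left_scalar (comult_sq \<Delta>) (exp_L t) (exp_L s) = exp_L (t + s)"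
  by (rule conv_exp_add[OF coalgebra_sq clinear_L])

lemma \<delta>_\<mu>: "\<delta> \<circ> \<mu> t = exp_L t"
proof -
  have "\<delta> \<circ> right_scalar = left_scalar \<circ> tensor_map \<delta> id"
    by (rule tensor_ext) (simp_all add: tensor_map_elem clinear_scale scaleC_complex_eq)
  then have "\<delta> \<circ> \<mu> t = conv_with left_scalar (comult_sq \<Delta>) (\<delta> \<circ> mul) (id \<circ> exp_L t)"
    unfolding \<mu>_eq conv_with_post by (subst conv_with_maps) simp_all
  then show ?thesis
    by (simp add: \<delta>_mul conv_with_counit_left[OF coalgebra_sq])
qed

text \<open>
  For \<open>t \<ge> 0\<close> the deformation axiom gives \<open>\<Delta> \<circ> \<mu>\<^sub>t = (\<mu>\<^sub>t \<otimes> \<mu>\<^sub>0) \<circ> \<Delta>\<^sub>2\<close>, where \<open>\<Delta>\<^sub>2\<close> is the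
  comultiplication of the tensor square. Applying \<open>\<delta>\<close> to the first leg gives \<open>\<mu>\<^sub>t = e\<^sub>t \<star> \<mu>\<close>,
  to be compared with the formula \<open>\<mu>\<^sub>t = \<mu> \<star> e\<^sub>t\<close>.
\<close>

lemma exp_L_commutes_nonneg:
  assumes "t \<ge> 0"
  shows "conv_with left_scalar (comult_sq \<Delta>) (exp_L t) mul = conv_with right_scalar (comult_sq \<Delta>) mul (exp_L t)"
proof -
  have add: "\<Delta> \<circ> \<mu> (t + 0) = tensor_map (\<mu> t) (\<mu> 0) \<circ> comult_sq \<Delta>"
    using deformation assms unfolding additive_deformation_def by blast
  have "conv_with left_scalar \<Delta> \<delta> id \<circ> \<mu> (t + 0)
      = conv_with left_scalar (comult_sq \<Delta>) (\<delta> \<circ> \<mu> t) (id \<circ> \<mu> 0)"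
    by (rule conv_with_pre) (simp_all only: clinear_\<mu> clinear_structure clinear_id add)
  then show ?thesis
    by (simp add: conv_with_counit_left[OF coalgebra] \<delta>_\<mu> \<mu>_zero \<mu>_eq[symmetric])
qed

text \<open>
  Whatever commutes with an invertible functional commutes with its inverse, and \<open>e\<^sub>-\<^sub>t\<close> is the
  inverse of \<open>e\<^sub>t\<close>.
\<close>

lemma exp_L_commutes:
  "conv_with left_scalar (comult_sq \<Delta>) (exp_L t) mul = conv_with right_scalar (comult_sq \<Delta>) mul (exp_L t)"
proof (cases "t \<ge> 0")
  case False
  let ?l = "conv_with left_scalar (comult_sq \<Delta>)" and ?r = "conv_with right_scalar (comult_sq \<Delta>)"
  have assoc_r: "?r (?r m f) g = ?r m (?l f g)"
    and assoc_l: "?l f (?l g m) = ?l (?l f g) m"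
    and assoc_lr: "?l f (?r m g) = ?r (?l f m) g"
    if [simp]: "clinear m" "clinear f" "clinear g" for m :: "'b \<otimes> 'b \<Rightarrow> 'b" and f g :: "'b \<otimes> 'b \<Rightarrow> complex"
    by (rule conv_with_assoc[OF coalgebra_sq] conv_with_assoc[OF coalgebra_sq, symmetric];
        simp add: scaleC_scaleC scaleC_complex_eq mult.commute clinear_scale)+
  have nonneg: "?l (exp_L (- t)) mul = ?r mul (exp_L (- t))"
    using False by (intro exp_L_commutes_nonneg) simp
  have zero: "exp_L 0 = functional_tensor \<delta> \<delta>"
    by (rule conv_exp_zero)
  have "?l (exp_L t) mul = ?l (exp_L t) (?r mul (?l (exp_L (- t)) (exp_L t)))"
    by (simp add: exp_L_add zero conv_with_counit_right[OF coalgebra_sq])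
  also have "\<dots> = ?l (exp_L t) (?r (?l (exp_L (- t)) mul) (exp_L t))"
    by (simp add: assoc_r[symmetric] nonneg)
  also have "\<dots> = ?r (?l (?l (exp_L t) (exp_L (- t))) mul) (exp_L t)"
    by (simp add: assoc_l assoc_lr)
  also have "\<dots> = ?r mul (exp_L t)"
    by (simp add: exp_L_add zero conv_with_counit_left[OF coalgebra_sq])
  finally show ?thesis .
qed (rule exp_L_commutes_nonneg)

text \<open>
  The right-hand side is \<open>\<mu>(x\<^sub>1) \<otimes> e\<^sub>t(x\<^sub>2) e\<^sub>s(x\<^sub>3) \<mu>(x\<^sub>4)\<close> once the second factor is written
  as \<open>e\<^sub>s \<star> \<mu>\<close>. The two functionals combine to \<open>e\<^sub>t\<^sub>+\<^sub>s\<close>, which then commutes past \<open>\<mu>\<close> to the right end.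
\<close>

lemma \<Delta>_\<mu>_add: "\<Delta> \<circ> \<mu> (t + s) = tensor_map (\<mu> t) (\<mu> s) \<circ> comult_sq \<Delta>"
proof -
  let ?D = "comult_sq \<Delta>"
  have "tensor_map (\<mu> t) (\<mu> s) \<circ> ?D
      = conv_with id ?D (conv_with right_scalar ?D mul (exp_L t)) (conv_with left_scalar ?D (exp_L s) mul)"
    by (simp add: \<mu>_eq exp_L_commutes conv_with_def[of id])
  also have "\<dots> = conv_with id ?D mul (conv_with left_scalar ?D (exp_L t) (conv_with left_scalar ?D (exp_L s) mul))"
    by (rule conv_with_assoc[OF coalgebra_sq]) (simp_all add: tensor_elem_simps)
  also have "\<dots> = conv_with id ?D mul (conv_with left_scalar ?D (exp_L (t + s)) mul)"
    unfolding exp_L_add[symmetric]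
    by (subst conv_with_assoc[OF coalgebra_sq, of left_scalar left_scalar left_scalar left_scalar])
       (simp_all add: scaleC_scaleC scaleC_complex_eq)
  also have "\<dots> = conv_with id ?D mul (conv_with right_scalar ?D mul (exp_L (t + s)))"
    by (simp add: exp_L_commutes)
  also have "\<dots> = conv_with right_scalar ?D (conv_with id ?D mul mul) (exp_L (t + s))"
    by (rule conv_with_assoc[OF coalgebra_sq, symmetric]) (simp_all add: tensor_elem_simps)
  also have "conv_with id ?D mul mul = \<Delta> \<circ> mul"
    by (simp add: conv_with_def \<Delta>_mul)
  also have "conv_with right_scalar ?D (\<Delta> \<circ> mul) (exp_L (t + s)) = \<Delta> \<circ> \<mu> (t + s)"
  proof -
    have "right_scalar \<circ> tensor_map \<Delta> id = \<Delta> \<circ> right_scalar"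
      by (rule tensor_ext) (simp_all add: tensor_map_elem clinear_scale)
    then show ?thesis
      unfolding \<mu>_eq conv_with_post using conv_with_maps[of \<Delta> "id :: complex \<Rightarrow> complex" mul "exp_L (t + s)" right_scalar ?D]
      by simp
  qed
  finally show ?thesis ..
qed

text \<open>
  The unit is group-like, so \<open>a \<mapsto> \<mu>\<^sub>t(1 \<otimes> a)\<close> is an additive family over the coalgebra \<open>B\<close>; so is
  the constant family of identities, and the two agree for \<open>t \<ge> 0\<close>.
\<close>

lemma \<mu>_one_left: "\<mu> t (one \<otimes>\<^sub>e a) = a"
proof -
  define i where "i a = one \<otimes>\<^sub>e a" for a :: 'b
  have [simp]: "clinear i"
    by (simp add: i_def clinear_iff tensor_elem_simps)
  have "(\<lambda>s. middle_flip ((one \<otimes>\<^sub>e one) \<otimes>\<^sub>e s)) = tensor_map i i"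
    by (rule tensor_ext, rule clinear_slots) (simp_all add: i_def middle_flip_elem tensor_map_elem)
  then have D: "comult_sq \<Delta> \<circ> i = tensor_map i i \<circ> \<Delta>"
    by (simp add: fun_eq_iff i_def comult_sq_def tensor_map_elem \<Delta>_one)
  have "\<mu> t \<circ> i = id"
  proof (rule additive_family_eq[OF coalgebra coalgebra, where A = "\<lambda>t. \<mu> t \<circ> i" and A' = "\<lambda>t. id"])
    fix t s
    show "\<Delta> \<circ> (\<mu> (t + s) \<circ> i) = tensor_map (\<mu> t \<circ> i) (\<mu> s \<circ> i) \<circ> \<Delta>"
      by (simp add: comp_reassoc[OF \<Delta>_\<mu>_add] D comp_assoc flip: tensor_map_comp)
    show "\<mu> t \<circ> i = id" if "t \<ge> 0"
      using deformation that
      by (simp add: additive_deformation_def unital_algebra_def i_def fun_eq_iff)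
    show "\<delta> \<circ> (\<mu> 0 \<circ> i) = \<delta>"
      using bialgebra by (simp add: \<mu>_zero bialgebra_def unital_algebra_def i_def fun_eq_iff)
  qed (simp_all add: tensor_map_id)
  then show ?thesis
    by (simp add: i_def fun_eq_iff)
qed

lemma \<mu>_one_right: "\<mu> t (a \<otimes>\<^sub>e one) = a"
proof -
  define i where "i a = a \<otimes>\<^sub>e one" for a :: 'b
  have [simp]: "clinear i"
    by (simp add: i_def clinear_iff tensor_elem_simps)
  have "(\<lambda>s. middle_flip (s \<otimes>\<^sub>e (one \<otimes>\<^sub>e one))) = tensor_map i i"
    by (rule tensor_ext, rule clinear_slots) (simp_all add: i_def middle_flip_elem tensor_map_elem)
  then have D: "comult_sq \<Delta> \<circ> i = tensor_map i i \<circ> \<Delta>"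
    by (simp add: fun_eq_iff i_def comult_sq_def tensor_map_elem \<Delta>_one)
  have "\<mu> t \<circ> i = id"
  proof (rule additive_family_eq[OF coalgebra coalgebra, where A = "\<lambda>t. \<mu> t \<circ> i" and A' = "\<lambda>t. id"])
    fix t s
    show "\<Delta> \<circ> (\<mu> (t + s) \<circ> i) = tensor_map (\<mu> t \<circ> i) (\<mu> s \<circ> i) \<circ> \<Delta>"
      by (simp add: comp_reassoc[OF \<Delta>_\<mu>_add] D comp_assoc flip: tensor_map_comp)
    show "\<mu> t \<circ> i = id" if "t \<ge> 0"
      using deformation that
      by (simp add: additive_deformation_def unital_algebra_def i_def fun_eq_iff)
    show "\<delta> \<circ> (\<mu> 0 \<circ> i) = \<delta>"
      using bialgebra by (simp add: \<mu>_zero bialgebra_def unital_algebra_def i_def fun_eq_iff)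
  qed (simp_all add: tensor_map_id)
  then show ?thesis
    by (simp add: i_def fun_eq_iff)
qed

text \<open>
  The two bracketings of a triple product are additive families over the coalgebra
  \<open>(B \<otimes> B) \<otimes> B\<close>, with comultiplication \<open>?D3\<close> below.
\<close>

lemma \<mu>_assoc: "\<mu> t \<circ> tensor_map (\<mu> t) id = \<mu> t \<circ> tensor_map id (\<mu> t) \<circ> tensor_assoc"
proof -
  let ?D = "comult_sq \<Delta>" and ?D3 = "tensor_comult (comult_sq \<Delta>) \<Delta>"
  have D3: "coalgebra ?D3 (functional_tensor (functional_tensor \<delta> \<delta>) \<delta>)"
    by (rule coalgebra_tensor[OF coalgebra_sq coalgebra])
  have assoc_D3: "middle_flip \<circ> (tensor_map \<Delta> ?D \<circ> tensor_assoc) = tensor_map tensor_assoc tensor_assoc \<circ> ?D3"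
  proof -
    have "middle_flip \<circ> (tensor_map \<Delta> ?D \<circ> tensor_assoc)
        = middle_flip \<circ> tensor_map id middle_flip \<circ> (tensor_map \<Delta> (tensor_map \<Delta> \<Delta>) \<circ> tensor_assoc)"
      by (simp add: comult_sq_def tensor_map_comps)
    also have "\<dots> = middle_flip \<circ> tensor_map id middle_flip \<circ> tensor_assoc \<circ> tensor_map (tensor_map \<Delta> \<Delta>) \<Delta>"
      by (simp add: tensor_assoc_natural comp_assoc)
    also have "\<dots> = tensor_map tensor_assoc tensor_assoc \<circ> ?D3"
      unfolding middle_flip_assoc by (simp add: comult_sq_def tensor_comult_def tensor_map_comps)
    finally show ?thesis .
  qed
  have nat: "middle_flip \<circ> (tensor_map (tensor_map f g) (tensor_map h k) \<circ> x)
      = tensor_map (tensor_map f h) (tensor_map g k) \<circ> (middle_flip \<circ> x)"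
    if "clinear f" "clinear g" "clinear h" "clinear k" for f g h k x
    using comp_reassoc[OF middle_flip_natural[OF that]] by (simp add: comp_assoc)
  show ?thesis
  proof (rule additive_family_eq[OF D3 coalgebra, where A = "\<lambda>t. \<mu> t \<circ> tensor_map (\<mu> t) id"
        and A' = "\<lambda>t. \<mu> t \<circ> tensor_map id (\<mu> t) \<circ> tensor_assoc"])
    fix t s
    have "\<Delta> \<circ> (\<mu> (t + s) \<circ> tensor_map (\<mu> (t + s)) id)
        = tensor_map (\<mu> t) (\<mu> s) \<circ> (middle_flip \<circ> tensor_map (\<Delta> \<circ> \<mu> (t + s)) (tensor_map id id \<circ> \<Delta>))"
      by (simp add: comp_reassoc[OF \<Delta>_\<mu>_add] comult_sq_def tensor_map_id tensor_map_comps)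
    also have "\<dots> = tensor_map (\<mu> t) (\<mu> s) \<circ> (middle_flip \<circ>
        (tensor_map (tensor_map (\<mu> t) (\<mu> s)) (tensor_map id id) \<circ> tensor_map ?D \<Delta>))"
      unfolding \<Delta>_\<mu>_add by (simp add: tensor_map_comp)
    also have "\<dots> = tensor_map (\<mu> t \<circ> tensor_map (\<mu> t) id) (\<mu> s \<circ> tensor_map (\<mu> s) id) \<circ> ?D3"
      by (subst nat) (simp_all add: tensor_map_comps tensor_comult_def)
    finally show "\<Delta> \<circ> (\<mu> (t + s) \<circ> tensor_map (\<mu> (t + s)) id)
        = tensor_map (\<mu> t \<circ> tensor_map (\<mu> t) id) (\<mu> s \<circ> tensor_map (\<mu> s) id) \<circ> ?D3" .
    have "\<Delta> \<circ> (\<mu> (t + s) \<circ> tensor_map id (\<mu> (t + s)) \<circ> tensor_assoc)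
        = tensor_map (\<mu> t) (\<mu> s) \<circ> (middle_flip \<circ> (tensor_map (tensor_map id id \<circ> \<Delta>) (\<Delta> \<circ> \<mu> (t + s)) \<circ> tensor_assoc))"
      by (simp add: comp_reassoc[OF \<Delta>_\<mu>_add] comult_sq_def tensor_map_id tensor_map_comps)
    also have "\<dots> = tensor_map (\<mu> t) (\<mu> s) \<circ> (middle_flip \<circ>
        (tensor_map (tensor_map id id) (tensor_map (\<mu> t) (\<mu> s)) \<circ> (tensor_map \<Delta> ?D \<circ> tensor_assoc)))"
      unfolding \<Delta>_\<mu>_add by (simp add: tensor_map_comps)
    also have "\<dots> = tensor_map (\<mu> t) (\<mu> s) \<circ> (tensor_map (tensor_map id (\<mu> t)) (tensor_map id (\<mu> s)) \<circ>
        (middle_flip \<circ> (tensor_map \<Delta> ?D \<circ> tensor_assoc)))"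
      by (subst nat) simp_all
    also have "\<dots> = tensor_map (\<mu> t \<circ> tensor_map id (\<mu> t) \<circ> tensor_assoc)
        (\<mu> s \<circ> tensor_map id (\<mu> s) \<circ> tensor_assoc) \<circ> ?D3"
      unfolding assoc_D3 by (simp add: tensor_map_comps)
    finally show "\<Delta> \<circ> (\<mu> (t + s) \<circ> tensor_map id (\<mu> (t + s)) \<circ> tensor_assoc)
        = tensor_map (\<mu> t \<circ> tensor_map id (\<mu> t) \<circ> tensor_assoc)
        (\<mu> s \<circ> tensor_map id (\<mu> s) \<circ> tensor_assoc) \<circ> ?D3" .
    show "\<mu> t \<circ> tensor_map (\<mu> t) id = \<mu> t \<circ> tensor_map id (\<mu> t) \<circ> tensor_assoc" if "t \<ge> 0"
      using deformation that by (simp add: additive_deformation_def unital_algebra_def)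
  next
    have "\<delta> \<circ> (\<mu> 0 \<circ> tensor_map (\<mu> 0) id) = (\<delta> \<circ> mul) \<circ> tensor_map mul id"
      by (simp add: \<mu>_zero comp_assoc)
    also have "\<dots> = left_scalar \<circ> tensor_map (\<delta> \<circ> mul) \<delta>"
      unfolding \<delta>_mul functional_tensor_eq[OF clinear_structure(3,3)]
      by (simp only: comp_assoc) (simp add: tensor_map_comp \<delta>_mul functional_tensor_eq)
    also have "\<dots> = functional_tensor (functional_tensor \<delta> \<delta>) \<delta>"
      by (simp add: \<delta>_mul functional_tensor_eq[of "functional_tensor \<delta> \<delta>"])
    finally show "\<delta> \<circ> (\<mu> 0 \<circ> tensor_map (\<mu> 0) id) = functional_tensor (functional_tensor \<delta> \<delta>) \<delta>" .
  qed simp_all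
qed

lemma unital_algebra_\<mu>: "unital_algebra (\<mu> t) one"
  by (simp add: unital_algebra_def \<mu>_assoc \<mu>_one_left \<mu>_one_right)

end


section \<open>Antipodes\<close>

lemma conv_inverse_unique:
  assumes co: "coalgebra D \<epsilon>" and alg: "unital_algebra m u"
    and [simp]: "clinear f" "clinear g" "clinear h"
    and fg: "conv_with m D f g = (\<lambda>c. \<epsilon> c *\<^sub>C u)" and gh: "conv_with m D g h = (\<lambda>c. \<epsilon> c *\<^sub>C u)"
  shows "f = h"
proof -
  have [simp]: "clinear m" "clinear D" "clinear \<epsilon>"
    and u: "\<And>a. m (u \<otimes>\<^sub>e a) = a" "\<And>a. m (a \<otimes>\<^sub>e u) = a"
    and assoc: "m \<circ> tensor_map m id = m \<circ> tensor_map id m \<circ> tensor_assoc"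
    using co alg by (simp_all add: unital_algebra_def coalgebra_clinear)
  have assoc': "m (m (x \<otimes>\<^sub>e y) \<otimes>\<^sub>e z) = m (x \<otimes>\<^sub>e m (y \<otimes>\<^sub>e z))" for x y z
    using fun_cong[OF assoc, of "(x \<otimes>\<^sub>e y) \<otimes>\<^sub>e z"] by (simp add: tensor_map_elem tensor_assoc_elem)
  have "m \<circ> tensor_map (\<lambda>c. \<epsilon> c *\<^sub>C u) h = left_scalar \<circ> tensor_map \<epsilon> h"
    and "m \<circ> tensor_map f (\<lambda>c. \<epsilon> c *\<^sub>C u) = right_scalar \<circ> tensor_map f \<epsilon>"
    by (rule tensor_ext; simp add: tensor_map_elem tensor_elem_simps clinear_scale u)+
  then have "conv_with m D (\<lambda>c. \<epsilon> c *\<^sub>C u) h = h" and "conv_with m D f (\<lambda>c. \<epsilon> c *\<^sub>C u) = f"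
    using conv_with_counit_left[OF co, of h] conv_with_counit_right[OF co, of f]
    by (simp_all add: conv_with_def)
  moreover have "conv_with m D (conv_with m D f g) h = conv_with m D f (conv_with m D g h)"
    by (rule conv_with_assoc[OF co]) (simp_all add: assoc')
  ultimately show ?thesis
    by (simp add: fg gh)
qed

locale deformed_hopf_algebra = deformed_bialgebra mul one \<Delta> \<delta> L \<mu>
  for mul :: "'b::complex_vector \<otimes> 'b \<Rightarrow> 'b" and one \<Delta> \<delta> L \<mu> +
  fixes S :: "real \<Rightarrow> 'b \<Rightarrow> 'b"
  assumes antipode: "antipode_family one \<Delta> \<delta> \<mu> S"
begin

lemma clinear_S [simp]: "clinear (S t)"
  and S_id: "conv_with (\<mu> t) \<Delta> (S t) id = (\<lambda>a. \<delta> a *\<^sub>C one)"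
  and id_S: "conv_with (\<mu> t) \<Delta> id (S t) = (\<lambda>a. \<delta> a *\<^sub>C one)"
  using antipode by (simp_all add: antipode_family_def conv_with_def)

lemma \<mu>_assoc_elem: "\<mu> t (\<mu> t (x \<otimes>\<^sub>e y) \<otimes>\<^sub>e z) = \<mu> t (x \<otimes>\<^sub>e \<mu> t (y \<otimes>\<^sub>e z))"
  using fun_cong[OF \<mu>_assoc, of t "(x \<otimes>\<^sub>e y) \<otimes>\<^sub>e z"] by (simp add: tensor_map_elem tensor_assoc_elem)

lemma antipode_unique:
  assumes "antipode_family one \<Delta> \<delta> \<mu> S'"
  shows "S' = S"
proof
  fix t
  have "clinear (S' t)" "conv_with (\<mu> t) \<Delta> (S' t) id = (\<lambda>a. \<delta> a *\<^sub>C one)"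
    using assms by (simp_all add: antipode_family_def conv_with_def)
  then show "S' t = S t"
    by (intro conv_inverse_unique[OF coalgebra unital_algebra_\<mu> _ clinear_id(1) clinear_S _ id_S]) simp_all
qed

lemma S_one: "S t one = one"
  using fun_cong[OF S_id, of t one] by (simp add: conv_with_def \<Delta>_one \<delta>_one tensor_map_elem \<mu>_one_right scaleC_one)

text \<open>
  Both sides are convolution inverses of \<open>\<mu>\<^sub>t\<close> among the maps from the coalgebra \<open>B \<otimes> B\<close> to the
  algebra \<open>B\<^sub>t\<close>. For the left-hand side this is the antipode equation composed with the undeformed
  product, since \<open>\<Delta> \<circ> \<mu>\<^sub>0 = (\<mu>\<^sub>-\<^sub>t \<otimes> \<mu>\<^sub>t) \<circ> \<Delta>\<^sub>2\<close>; this is where the sign of the parameter comes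
  from. For the right-hand side it is the computation \<open>a\<^sub>1 b\<^sub>1 S(b\<^sub>2) S(a\<^sub>2) = \<delta>(a) \<delta>(b) 1\<close> in \<open>B\<^sub>t\<close>.
\<close>

lemma S_antihomomorphism: "S t \<circ> \<mu> (- t) = \<mu> t \<circ> tensor_map (S t) (S t) \<circ> flip"
proof (rule conv_inverse_unique[OF coalgebra_sq unital_algebra_\<mu>])
  let ?D = "comult_sq \<Delta>"
  have "conv_with (\<mu> t) \<Delta> (S t) id \<circ> \<mu> 0 = conv_with (\<mu> t) ?D (S t \<circ> \<mu> (- t)) (id \<circ> \<mu> t)"
    using \<Delta>_\<mu>_add[of "- t" t] by (intro conv_with_pre) simp_all
  then show "conv_with (\<mu> t) ?D (S t \<circ> \<mu> (- t)) (\<mu> t) = (\<lambda>x. functional_tensor \<delta> \<delta> x *\<^sub>C one)"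
    by (simp add: S_id \<mu>_zero fun_eq_iff \<delta>_mul[symmetric])
  let ?anti = "\<mu> t \<circ> tensor_map (S t) (S t) \<circ> flip"
  \<comment> \<open>\<open>G ((p \<otimes> q) \<otimes> z) = p (z S(q))\<close>; below \<open>z = b\<^sub>1 S(b\<^sub>2)\<close>.\<close>
  define G where "G = \<mu> t \<circ> tensor_map id (\<mu> t \<circ> tensor_map id (S t) \<circ> flip) \<circ> tensor_assoc"
  have [simp]: "clinear G"
    by (simp add: G_def)
  have G: "\<mu> t \<circ> tensor_map (\<mu> t) ?anti \<circ> middle_flip = G \<circ> tensor_map id (\<mu> t \<circ> tensor_map id (S t))"
    by (rule tensor_ext_both)
       (simp_all add: G_def tensor_map_elem tensor_assoc_elem middle_flip_elem flip_elem \<mu>_assoc_elem)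
  have G_one: "(\<lambda>x. G (x \<otimes>\<^sub>e one)) = \<mu> t \<circ> tensor_map id (S t)"
    by (rule tensor_ext, rule clinear_slots(1)[where f = G])
       (simp_all, simp add: G_def tensor_map_elem tensor_assoc_elem flip_elem \<mu>_one_left)
  have "conv_with (\<mu> t) ?D (\<mu> t) ?anti = G \<circ> tensor_map \<Delta> (\<lambda>b. \<delta> b *\<^sub>C one)"
  proof -
    have "conv_with (\<mu> t) ?D (\<mu> t) ?anti = (\<mu> t \<circ> tensor_map (\<mu> t) ?anti \<circ> middle_flip) \<circ> tensor_map \<Delta> \<Delta>"
      by (simp add: conv_with_def comult_sq_def comp_assoc)
    also have "\<dots> = G \<circ> tensor_map \<Delta> (conv_with (\<mu> t) \<Delta> id (S t))"
      unfolding G by (simp add: conv_with_def tensor_map_comps)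
    finally show ?thesis
      by (simp add: id_S)
  qed
  also have "\<dots> = (\<lambda>x. functional_tensor \<delta> \<delta> x *\<^sub>C one)"
  proof (rule tensor_ext)
    fix a b
    show "(G \<circ> tensor_map \<Delta> (\<lambda>b. \<delta> b *\<^sub>C one)) (a \<otimes>\<^sub>e b) = functional_tensor \<delta> \<delta> (a \<otimes>\<^sub>e b) *\<^sub>C one"
      using fun_cong[OF G_one, of "\<Delta> a"] fun_cong[OF id_S[of t], of a]
      by (simp add: tensor_map_elem tensor_elem_simps clinear_scale functional_tensor_elem
          conv_with_def scaleC_scaleC mult.commute)
  qed simp_all
  finally show "conv_with (\<mu> t) ?D (\<mu> t) ?anti = (\<lambda>x. functional_tensor \<delta> \<delta> x *\<^sub>C one)" .
qed simp_all

text \<open>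
  Both sides are convolution inverses of \<open>\<Delta>\<close> among the maps from \<open>B\<close> to the algebra
  \<open>B\<^sub>t \<otimes> B\<^sub>r\<close>. For the left-hand side, \<open>\<Delta>\<close> is a homomorphism from \<open>B\<^sub>t\<^sub>+\<^sub>r\<close>. For the right-hand
  side, the two inclusions \<open>i\<close> and \<open>j\<close> of the tensor factors satisfy \<open>\<Delta> = i \<star> j\<close>, and the
  right-hand side is \<open>(j \<circ> S\<^sub>r) \<star> (i \<circ> S\<^sub>t)\<close>, so the product telescopes. This avoids coassociativity
  in four factors.
\<close>

lemma \<Delta>_S: "\<Delta> \<circ> S (t + r) = tensor_map (S t) (S r) \<circ> flip \<circ> \<Delta>"
proof -
  define m where "m = tensor_map (\<mu> t) (\<mu> r) \<circ> middle_flip"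
  let ?u = "one \<otimes>\<^sub>e one"
  have alg: "unital_algebra m ?u"
    unfolding m_def by (rule unital_algebra_tensor[OF unital_algebra_\<mu> unital_algebra_\<mu>])
  have m_elem: "m ((a \<otimes>\<^sub>e b) \<otimes>\<^sub>e (c \<otimes>\<^sub>e d)) = \<mu> t (a \<otimes>\<^sub>e c) \<otimes>\<^sub>e \<mu> r (b \<otimes>\<^sub>e d)" for a b c d
    by (simp add: m_def middle_flip_elem tensor_map_elem)
  have [simp]: "clinear m"
    by (simp add: m_def)
  have m_assoc: "m (m (x \<otimes>\<^sub>e y) \<otimes>\<^sub>e z) = m (x \<otimes>\<^sub>e m (y \<otimes>\<^sub>e z))" for x y z
  proof -
    have "m \<circ> tensor_map m id = m \<circ> tensor_map id m \<circ> tensor_assoc"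
      using alg by (simp add: unital_algebra_def)
    from fun_cong[OF this, of "(x \<otimes>\<^sub>e y) \<otimes>\<^sub>e z"] show ?thesis
      by (simp add: tensor_map_elem tensor_assoc_elem)
  qed
  let ?i = "\<lambda>b::'b. b \<otimes>\<^sub>e one" and ?j = "\<lambda>b::'b. one \<otimes>\<^sub>e b"
  have [simp]: "clinear ?i" "clinear ?j"
    by (simp_all add: clinear_iff tensor_elem_simps)
  let ?unit = "\<lambda>a. \<delta> a *\<^sub>C ?u"
  have ii: "conv_with m \<Delta> ?i (?i \<circ> S t) = ?unit"
  proof -
    have "m \<circ> tensor_map ?i ?i = ?i \<circ> \<mu> t"
      by (rule tensor_ext) (simp_all add: tensor_map_elem m_elem \<mu>_one_left)
    then have "conv_with m \<Delta> (?i \<circ> id) (?i \<circ> S t) = ?i \<circ> conv_with (\<mu> t) \<Delta> id (S t)"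
      by (subst conv_with_maps) (simp_all add: conv_with_post)
    then show ?thesis
      by (simp add: id_S fun_eq_iff tensor_elem_simps)
  qed
  have jj: "conv_with m \<Delta> ?j (?j \<circ> S r) = ?unit"
  proof -
    have "m \<circ> tensor_map ?j ?j = ?j \<circ> \<mu> r"
      by (rule tensor_ext) (simp_all add: tensor_map_elem m_elem \<mu>_one_left)
    then have "conv_with m \<Delta> (?j \<circ> id) (?j \<circ> S r) = ?j \<circ> conv_with (\<mu> r) \<Delta> id (S r)"
      by (subst conv_with_maps) (simp_all add: conv_with_post)
    then show ?thesis
      by (simp add: id_S fun_eq_iff tensor_elem_simps)
  qed
  have "m \<circ> tensor_map ?i ?j = id"
    by (rule tensor_ext) (simp_all add: tensor_map_elem m_elem \<mu>_one_left \<mu>_one_right)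
  then have \<Delta>_ij: "\<Delta> = conv_with m \<Delta> ?i ?j"
    by (simp add: conv_with_def)
  have "m \<circ> tensor_map (?j \<circ> S r) (?i \<circ> S t) = tensor_map (S t) (S r) \<circ> flip"
    by (rule tensor_ext) (simp_all add: tensor_map_elem m_elem flip_elem \<mu>_one_left \<mu>_one_right)
  then have S_ji: "tensor_map (S t) (S r) \<circ> flip \<circ> \<Delta> = conv_with m \<Delta> (?j \<circ> S r) (?i \<circ> S t)"
    by (simp add: conv_with_def)
  show ?thesis
  proof (rule conv_inverse_unique[OF coalgebra alg])
    have "\<Delta> \<circ> \<mu> (t + r) = m \<circ> tensor_map \<Delta> \<Delta>"
      by (simp add: m_def \<Delta>_\<mu>_add comult_sq_def comp_assoc)
    then have "conv_with m \<Delta> (\<Delta> \<circ> S (t + r)) (\<Delta> \<circ> id) = \<Delta> \<circ> conv_with (\<mu> (t + r)) \<Delta> (S (t + r)) id"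
      by (subst conv_with_maps) (simp_all add: conv_with_post)
    then show "conv_with m \<Delta> (\<Delta> \<circ> S (t + r)) \<Delta> = ?unit"
      by (simp add: S_id fun_eq_iff clinear_scale \<Delta>_one)
    have "conv_with m \<Delta> (conv_with m \<Delta> ?i ?j) (conv_with m \<Delta> (?j \<circ> S r) (?i \<circ> S t))
        = conv_with m \<Delta> ?i (conv_with m \<Delta> ?j (conv_with m \<Delta> (?j \<circ> S r) (?i \<circ> S t)))"
      by (rule conv_with_assoc[OF coalgebra]) (simp_all add: m_assoc)
    also have "conv_with m \<Delta> ?j (conv_with m \<Delta> (?j \<circ> S r) (?i \<circ> S t))
        = conv_with m \<Delta> (conv_with m \<Delta> ?j (?j \<circ> S r)) (?i \<circ> S t)"
      by (rule conv_with_assoc[OF coalgebra, symmetric]) (simp_all add: m_assoc)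
    also have "\<dots> = ?i \<circ> S t"
    proof -
      have "m (?u \<otimes>\<^sub>e x) = x" for x
        using alg by (simp add: unital_algebra_def)
      then have "m \<circ> tensor_map ?unit (?i \<circ> S t) = left_scalar \<circ> tensor_map \<delta> (?i \<circ> S t)"
        by (intro tensor_ext) (simp_all add: tensor_map_elem tensor_elem_simps clinear_scale)
      then show ?thesis
        unfolding jj using conv_with_counit_left[OF coalgebra, of "?i \<circ> S t"]
        by (simp add: conv_with_def)
    qed
    finally show "conv_with m \<Delta> \<Delta> (tensor_map (S t) (S r) \<circ> flip \<circ> \<Delta>) = ?unit"
      by (simp only: S_ji \<Delta>_ij[symmetric] ii)
  qed simp_all
qed

text \<open>
  Cocommutativity allows the antihomomorphism property to be applied to \<open>(S\<^sub>t \<circ> S\<^sub>-\<^sub>t) \<star> S\<^sub>t\<close>, which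
  becomes \<open>S\<^sub>t \<circ> (id \<star> S\<^sub>-\<^sub>t)\<close>, with the second product in \<open>B\<^sub>-\<^sub>t\<close>. So \<open>S\<^sub>t \<circ> S\<^sub>-\<^sub>t\<close> is an inverse of
  \<open>S\<^sub>t\<close>, as is \<open>id\<close>.
\<close>

lemma S_S_uminus:
  assumes "cocommutative \<Delta>"
  shows "S t \<circ> S (- t) = id"
proof (rule conv_inverse_unique[OF coalgebra unital_algebra_\<mu> _ clinear_S _ _ S_id])
  have "conv_with (\<mu> t) \<Delta> (S t \<circ> S (- t)) (S t \<circ> id)
      = \<mu> t \<circ> tensor_map (S t) (S t) \<circ> tensor_map (S (- t)) id \<circ> (flip \<circ> \<Delta>)"
    using assms by (simp add: conv_with_def cocommutative_def tensor_map_comps)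
  also have "\<dots> = (\<mu> t \<circ> tensor_map (S t) (S t) \<circ> flip) \<circ> tensor_map id (S (- t)) \<circ> \<Delta>"
    by (simp add: comp_assoc comp_reassoc[OF tensor_map_flip])
  also have "\<dots> = S t \<circ> conv_with (\<mu> (- t)) \<Delta> id (S (- t))"
    unfolding S_antihomomorphism[symmetric] by (simp only: conv_with_def comp_assoc)
  also have "\<dots> = (\<lambda>a. \<delta> a *\<^sub>C one)"
    by (simp add: id_S fun_eq_iff clinear_scale S_one)
  finally show "conv_with (\<mu> t) \<Delta> (S t \<circ> S (- t)) (S t) = (\<lambda>a. \<delta> a *\<^sub>C one)"
    by simp
qed simp_all

lemma S_inverse:
  assumes "cocommutative \<Delta>"
  shows "bij (S t)" "inv (S t) = S (- t)"
proof -
  have "S t \<circ> S (- t) = id" "S (- t) \<circ> S t = id"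
    using S_S_uminus[OF assms, of t] S_S_uminus[OF assms, of "- t"] by simp_all
  then show "bij (S t)" "inv (S t) = S (- t)"
    by (auto intro: o_bij inv_unique_comp)
qed

end

theorem theorem3:
  fixes mul :: "'b::complex_vector \<otimes> 'b \<Rightarrow> 'b"
    and one :: 'b
    and \<Delta> :: "'b \<Rightarrow> 'b \<otimes> 'b"
    and \<delta> :: "'b \<Rightarrow> complex"
    and L :: "'b \<otimes> 'b \<Rightarrow> complex"
    and \<mu> :: "real \<Rightarrow> 'b \<otimes> 'b \<Rightarrow> 'b"
    and S :: "real \<Rightarrow> 'b \<Rightarrow> 'b"
  assumes "bialgebra mul one \<Delta> \<delta>"
    and "additive_deformation mul one \<Delta> \<delta> \<mu>"
    and "clinear L" and "normalized one L" and "commuting mul \<Delta> L" and "two_cocycle mul \<delta> L"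
    and "\<forall>t. \<mu> t = deformed_mult mul \<Delta> \<delta> L t"
    and "antipode_family one \<Delta> \<delta> \<mu> S"
  shows "(\<forall>S'. antipode_family one \<Delta> \<delta> \<mu> S' \<longrightarrow> S' = S)
    \<and> (\<forall>t. S t one = one)
    \<and> (\<forall>t. S t \<circ> \<mu> (- t) = \<mu> t \<circ> tensor_map (S t) (S t) \<circ> flip)
    \<and> (\<forall>t r. \<Delta> \<circ> S (t + r) = tensor_map (S t) (S r) \<circ> flip \<circ> \<Delta>)
    \<and> (cocommutative \<Delta> \<longrightarrow> (\<forall>t. bij (S t) \<and> inv (S t) = S (- t)))"
proof -
  interpret deformed_hopf_algebra mul one \<Delta> \<delta> L \<mu> S
    by (intro deformed_hopf_algebra.intro deformed_bialgebra.intro deformed_hopf_algebra_axioms.intro)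
       (use assms in blast)+
  show ?thesis
    using antipode_unique S_one S_antihomomorphism \<Delta>_S S_inverse by blast
qed

end
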